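(* Let $n\ge 1$, let $B\in\mathscr{S}_n(\mathbb{C}^+)$ and let $\alpha$ be a unitary $n\times n$ matrix. The Lebesgue weight (Radon--Nikodym derivative with respect to Lebesgue measure $m$ on $\mathbb{R}$) of the absolutely continuous part of the Clark measure $\mu^{B\alpha^*}$ is given, for Lebesgue-almost every $s\in\mathbb{R}$, by $$\frac{d\mu^{B\alpha^*}}{dm}(s)=\frac{1}{\pi(1+s^2)}\lim_{w\downarrow s}\,(\alpha^*-B^*(w))^{-1}\,(I-B^*(w)B(w))\,(\alpha-B(w))^{-1},\qquad w\in\mathbb{C}^+ .$$
   Context: $\mathbb{C}^+$ is the open upper half-plane, $\mathbb{D}$ the open unit disk, $\mathbb{T}$ the unit circle. For an open set $X\subset\mathbb{C}$, $\mathscr{S}_n(X)$ denotes the set of contractive $n\times n$ matrix-valued analytic functions on $X$. $B^*(w)$ is the conjugate transpose of $B(w)$, and $\lim_{w\downarrow s}$ is the non-tangential limit as $w\in\mathbb{C}^+$ tends to $s\in\mathbb{R}$. The Cayley transform is $\gamma(w)=\frac{w-i}{w+i}$, a bijection of $\mathbb{C}^+$ onto $\mathbb{D}$ extending to a bijection of $\mathbb{R}$ onto $\mathbb{T}\setminus\{1\}$. Given $B\in\mathscr{S}_n(\mathbb{C}^+)$, let $b\in\mathscr{S}_n(\mathbb{D})$ be defined by $B(w)=b(\gamma(w))$. It is understood that $I-b(\zeta)\alpha^*$ is invertible for $\zeta\in\mathbb{D}$, so that the Clark measure is defined: $\mu^{b\alpha^*}$ is the unique nonnegative $n\times n$ matrix-valued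 Borel measure on $\mathbb{T}$ with $$\operatorname{Re}\big[(I-b(\zeta)\alpha^* )^{-1}(I+b(\zeta)\alpha^* )\big]=\int_{\mathbb{T}}\frac{1-|\zeta|^2}{|\lambda-\zeta|^2}\,\mu^{b\alpha^*}(d\lambda),\quad \zeta\in\mathbb{D},$$ where $\operatorname{Re}X=\frac12(X+X^* )$. The Clark measure on the line is here normalized as the transported measure $\mu^{B\alpha^*}(\Omega)=\mu^{b\alpha^*}(\gamma(\Omega))$ for Borel $\Omega\subseteq\mathbb{R}$; thus its absolutely continuous part has density $\frac{1}{\pi(1+s^2)}\frac{d\mu^{b\alpha^*}}{d\mathfrak{m}}(\gamma(s))$, where $\mathfrak{m}$ is normalized Lebesgue measure on $\mathbb{T}$. *)

theory Defs
  imports "HOL-Analysis.Analysis" "HOL-Complex_Analysis.Complex_Analysis"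
begin

type_synonym 'n cmat = "complex ^ 'n ^ 'n"

definition cadjoint :: "'n::finite cmat \<Rightarrow> 'n cmat" where
  "cadjoint A = (\<chi> i j. cnj (A $ j $ i))"

definition unitary_mat :: "'n::finite cmat \<Rightarrow> bool" where
  "unitary_mat A \<longleftrightarrow> cadjoint A ** A = mat 1 \<and> A ** cadjoint A = mat 1"

definition Re_mat :: "'n::finite cmat \<Rightarrow> 'n cmat" where
  "Re_mat X = (1 / 2) *\<^sub>R (X + cadjoint X)"

definition hform :: "'n::finite cmat \<Rightarrow> complex ^ 'n \<Rightarrow> complex" where
  "hform A v = (\<Sum>i\<in>UNIV. cnj (v $ i) * (A *v v) $ i)"

definition nonneg_mat :: "'n::finite cmat \<Rightarrow> bool" where
  "nonneg_mat A \<longleftrightarrow> (\<forall>v. hform A v \<in> \<real>\<^sub>\<ge>\<^sub>0)"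

text \<open>The norm on \<^typ>\<open>complex ^ 'n\<close> is the Euclidean one, so the second condition
  bounds the operator norm of every value by 1.\<close>

definition schur_class :: "complex set \<Rightarrow> (complex \<Rightarrow> 'n::finite cmat) set" where
  "schur_class X = {F. (\<forall>i j. (\<lambda>z. F z $ i $ j) analytic_on X) \<and>
                       (\<forall>z\<in>X. \<forall>v. norm (F z *v v) \<le> norm v)}"

definition upper_half_plane :: "complex set" where
  "upper_half_plane = {w. Im w > 0}"

definition cayley :: "complex \<Rightarrow> complex" where
  "cayley w = (w - \<i>) / (w + \<i>)"

text \<open>A nonnegative matrix-valued measure is a set function on the \<open>\<sigma>\<close>-algebra \<^term>\<open>sets M\<close>; of
  \<^term>\<open>M\<close> only the space and the measurable sets are used, and the values of \<^term>\<open>\<mu>\<close> on other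
  sets are irrelevant. Countable additivity forces \<^term>\<open>\<mu> {} = 0\<close>.\<close>

definition nonneg_matrix_measure :: "'a measure \<Rightarrow> ('a set \<Rightarrow> 'n::finite cmat) \<Rightarrow> bool" where
  "nonneg_matrix_measure M \<mu> \<longleftrightarrow>
     (\<forall>\<Omega>\<in>sets M. nonneg_mat (\<mu> \<Omega>)) \<and>
     (\<forall>A. range A \<subseteq> sets M \<longrightarrow> disjoint_family A \<longrightarrow> (\<lambda>k::nat. \<mu> (A k)) sums \<mu> (\<Union>k. A k))"

definition form_measure ::
  "'a measure \<Rightarrow> ('a set \<Rightarrow> 'n::finite cmat) \<Rightarrow> complex ^ 'n \<Rightarrow> 'a measure" where
  "form_measure M \<mu> v = measure_of (space M) (sets M) (\<lambda>\<Omega>. ennreal (Re (hform (\<mu> \<Omega>) v)))"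

text \<open>The integral of a scalar function is taken in the weak sense: it is the matrix whose
  Hermitian form at every vector \<open>v\<close> is the integral against the finite scalar measure
  \<open>\<Omega> \<mapsto> v\<^sup>* \<mu>(\<Omega>) v\<close>. By polarization this determines the matrix.\<close>

definition has_matrix_integral ::
  "'a measure \<Rightarrow> ('a set \<Rightarrow> 'n::finite cmat) \<Rightarrow> ('a \<Rightarrow> real) \<Rightarrow> 'n cmat \<Rightarrow> bool" where
  "has_matrix_integral M \<mu> f J \<longleftrightarrow>
     (\<forall>v. integrable (form_measure M \<mu> v) f \<and>
          hform J v = of_real (integral\<^sup>L (form_measure M \<mu> v) f))"

abbreviation circle_borel :: "complex measure" where
  "circle_borel \<equiv> restrict_space borel (sphere 0 1)"

definition is_clark_measure ::
  "(complex \<Rightarrow> 'n::finite cmat) \<Rightarrow> 'n cmat \<Rightarrow> (complex set \<Rightarrow> 'n cmat) \<Rightarrow> bool" where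
  "is_clark_measure b \<alpha> \<mu> \<longleftrightarrow>
     nonneg_matrix_measure circle_borel \<mu> \<and>
     (\<forall>\<zeta>\<in>ball 0 1.
        has_matrix_integral circle_borel \<mu>
          (\<lambda>l. (1 - (cmod \<zeta>)\<^sup>2) / (cmod (l - \<zeta>))\<^sup>2)
          (Re_mat (matrix_inv (mat 1 - b \<zeta> ** cadjoint \<alpha>) ** (mat 1 + b \<zeta> ** cadjoint \<alpha>))))"

definition line_measure :: "(complex set \<Rightarrow> 'n::finite cmat) \<Rightarrow> real set \<Rightarrow> 'n cmat" where
  "line_measure \<mu> \<Omega> = \<mu> ((\<lambda>s. cayley (complex_of_real s)) ` \<Omega>)"

definition lebesgue_decomposition ::
  "(real set \<Rightarrow> 'n::finite cmat) \<Rightarrow> (real set \<Rightarrow> 'n cmat) \<Rightarrow> (real set \<Rightarrow> 'n cmat) \<Rightarrow> bool" where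
  "lebesgue_decomposition \<nu> \<nu>a \<nu>s \<longleftrightarrow>
     nonneg_matrix_measure borel \<nu>a \<and> nonneg_matrix_measure borel \<nu>s \<and>
     (\<forall>\<Omega>\<in>sets borel. \<nu> \<Omega> = \<nu>a \<Omega> + \<nu>s \<Omega>) \<and>
     (\<forall>\<Omega>\<in>null_sets lborel. \<nu>a \<Omega> = 0) \<and>
     (\<exists>N\<in>null_sets lborel. \<forall>\<Omega>\<in>sets borel. \<Omega> \<inter> N = {} \<longrightarrow> \<nu>s \<Omega> = 0)"

definition has_lebesgue_density :: "(real set \<Rightarrow> 'n::finite cmat) \<Rightarrow> (real \<Rightarrow> 'n cmat) \<Rightarrow> bool" where
  "has_lebesgue_density \<nu> W \<longleftrightarrow>
     integrable lborel W \<and> (\<forall>\<Omega>\<in>sets borel. \<nu> \<Omega> = (LINT s:\<Omega>|lborel. W s))"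

text \<open>As for \<^const>\<open>RN_deriv\<close>, a version of the density, which is determined only up to null sets,
  is chosen.\<close>

definition ac_weight :: "(real set \<Rightarrow> 'n::finite cmat) \<Rightarrow> real \<Rightarrow> 'n cmat" where
  "ac_weight \<nu> = (SOME W. \<exists>\<nu>a \<nu>s. lebesgue_decomposition \<nu> \<nu>a \<nu>s \<and> has_lebesgue_density \<nu>a W)"

definition has_nontangential_limit ::
  "(complex \<Rightarrow> 'a::topological_space) \<Rightarrow> real \<Rightarrow> 'a \<Rightarrow> bool" where
  "has_nontangential_limit f s L \<longleftrightarrow>
     (\<forall>c>0. (f \<longlongrightarrow> L)
        (at (complex_of_real s) within {w \<in> upper_half_plane. \<bar>Re w - s\<bar> < c * Im w}))"

end

theory Submission
  imports Defs
begin

text \<open>Multiplying out, the matrix under the limit is the real part of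
  \<open>(I - b(\<zeta>)\<alpha>\<^sup>*)\<^sup>-\<^sup>1 (I + b(\<zeta>)\<alpha>\<^sup>*)\<close> at \<open>\<zeta> = cayley w\<close>, that is, the Poisson integral of the Clark
  measure. On the line the Poisson kernel becomes \<open>(1 + t\<^sup>2) Im w / |t - w|\<^sup>2\<close>, and the point \<open>1\<close> of the
  circle contributes only \<open>Im w * \<mu> {1}\<close>, which vanishes at the boundary. Hence the theorem is Fatou's
  theorem for the scalar measures \<open>v\<^sup>* \<mu> v\<close>, carried over to matrices by polarization. Fatou's theorem
  rests on one fact: if a finite measure \<open>\<rho>\<close> does not charge \<open>A\<close>, then, by the Vitali covering theorem,
  \<open>\<rho>\<close> has derivative \<open>0\<close> at almost every point of \<open>A\<close>, and there its Poisson integral tends to \<open>0\<close>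
  non-tangentially.\<close>

text \<open>The factor \<open>pi * (1 + s\<^sup>2)\<close> comes from the measure with density
  \<open>1 / (pi * (1 + t\<^sup>2))\<close>, the image of normalized arc length under the inverse
  Cayley map: its Poisson integral is constantly 1. For fixed w the kernel is bounded in t, so
  finiteness of the transported measure makes every integral exist. Two obstacles shape the matrix
  part. \<open>ac_weight\<close> is a choice, so nothing is known of it until a decomposition with
  an integrable density has been constructed; Fatou's theorem then applies to whichever version was
  chosen. Moreover, Fatou's theorem gives for each vector v an exceptional null set that depends on
  v. Polarization is therefore written with the countable family \<open>polar_vector i j k\<close>,
  which yields one null set for all matrix entries.\<close>

no_notation fps_nth (infixl "$" 75)

section \<open>Poisson integrals on the real line\<close>

text \<open>Consider the points of \<open>A\<close> at which the quotient exceeds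
  \<open>1 / Suc n\<close> at arbitrarily small radii. The balls can be taken inside an open
  \<open>U\<close> around \<open>A\<close> of small \<rho> measure. A disjoint Vitali subfamily
  covers almost all of these points, and each ball is no longer than \<open>2 * Suc n\<close> times
  its mass, so the total length is at most \<open>2 * Suc n\<close> times the mass of
  \<open>U\<close>.\<close>

lemma null_set_derivative_zero:
  fixes \<rho> :: "real measure"
  assumes fin: "finite_measure \<rho>" and sets: "sets \<rho> = sets borel"
    and A: "A \<in> sets borel" and A0: "emeasure \<rho> A = 0"
  shows "AE x in lborel. x \<in> A \<longrightarrow> ((\<lambda>r. measure \<rho> (cball x r) / r) \<longlongrightarrow> 0) (at_right 0)"
proof -
  interpret finite_measure \<rho> by fact
  have sets' [measurable_cong]: "sets \<rho> = sets borel" by fact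
  define E where "E n = {x\<in>A. \<forall>d>0. \<exists>r. 0 < r \<and> r < d \<and> r / real (Suc n) < measure \<rho> (cball x r)}" for n
  have "negligible (E n)" for n
    unfolding negligible_outer_le
  proof (intro allI impI)
    fix e :: real assume "e > 0"
    \<comment> \<open>Chosen so that the factor \<open>2 * Suc n\<close> between mass and length
      turns the mass bound \<eta> into the length bound \<open>e\<close>.\<close>
    define \<eta> where "\<eta> = e / (2 * real (Suc n))"
    have "\<eta> > 0" using \<open>e > 0\<close> by (simp add: \<eta>_def)
    have "emeasure \<rho> A = (INF U \<in> {U. A \<subseteq> U \<and> open U}. emeasure \<rho> U)"
      by (rule outer_regular[OF sets]) (use A in auto)
    then have "(INF U \<in> {U. A \<subseteq> U \<and> open U}. emeasure \<rho> U) < ennreal \<eta>"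
      using A0 \<open>\<eta> > 0\<close> by simp
    then obtain U where U: "A \<subseteq> U" "open U" "emeasure \<rho> U < ennreal \<eta>"
      unfolding INF_less_iff by auto
    define K where "K = {p. fst p \<in> E n \<and> 0 < snd p \<and> cball (fst p) (snd p) \<subseteq> U \<and>
        snd p / real (Suc n) < measure \<rho> (cball (fst p) (snd p))}"
    obtain C where C: "countable C" "C \<subseteq> K"
      "pairwise (\<lambda>i j. disjnt (cball (fst i) (snd i)) (cball (fst j) (snd j))) C"
      "negligible (E n - (\<Union>i\<in>C. cball (fst i) (snd i)))"
    proof (rule Vitali_covering_theorem_cballs[of K snd "E n" fst])
      show "0 < snd i" if "i \<in> K" for i using that by (simp add: K_def)
      show "\<exists>i. i \<in> K \<and> x \<in> cball (fst i) (snd i) \<and> snd i < d" if x: "x \<in> E n" and "0 < d" for x d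
      proof -
        have "x \<in> U" using x U(1) by (auto simp: E_def)
        then obtain d' where d': "d' > 0" "cball x d' \<subseteq> U" using U(2) open_contains_cball by blast
        have "min d d' > 0" using \<open>0 < d\<close> d'(1) by simp
        then obtain r where r: "0 < r" "r < min d d'" "r / real (Suc n) < measure \<rho> (cball x r)"
          using x unfolding E_def mem_Collect_eq by blast
        have "cball x r \<subseteq> U" using r(2) d'(2) by (auto simp: subset_iff)
        with r x have "(x, r) \<in> K" by (simp add: K_def)
        with r show ?thesis by (intro exI[of _ "(x, r)"]) auto
      qed
    qed auto
    let ?B = "\<lambda>i::real\<times>real. cball (fst i) (snd i)"
    let ?T = "(\<Union>i\<in>C. ?B i)"
    have disj: "disjoint_family_on ?B C"
      using C(3) by (auto simp: disjoint_family_on_def pairwise_def disjnt_def)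
    have T: "?T \<in> sets borel"
      using C(1) by (intro sets.countable_UN') auto
    have "emeasure lborel ?T = (\<integral>\<^sup>+i. emeasure lborel (?B i) \<partial>count_space C)"
      by (rule emeasure_UN_countable) (use C(1) disj in auto)
    also have "\<dots> \<le> (\<integral>\<^sup>+i. ennreal (2 * real (Suc n)) * emeasure \<rho> (?B i) \<partial>count_space C)"
    proof (rule nn_integral_mono)
      fix i assume "i \<in> space (count_space C)"
      then have i: "0 < snd i" "snd i / real (Suc n) < measure \<rho> (?B i)"
        using C(2) by (auto simp: K_def)
      have "emeasure lborel (?B i) = ennreal (2 * snd i)"
        using i(1) by (simp add: cball_eq_atLeastAtMost)
      also have "\<dots> \<le> ennreal (2 * real (Suc n) * measure \<rho> (?B i))"
        using i(2) by (intro ennreal_leI) (simp add: field_simps)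
      also have "\<dots> = ennreal (2 * real (Suc n)) * emeasure \<rho> (?B i)"
        by (simp add: emeasure_eq_measure ennreal_mult')
      finally show "emeasure lborel (?B i) \<le> ennreal (2 * real (Suc n)) * emeasure \<rho> (?B i)" .
    qed
    also have "\<dots> = ennreal (2 * real (Suc n)) * (\<integral>\<^sup>+i. emeasure \<rho> (?B i) \<partial>count_space C)"
      by (rule nn_integral_cmult) auto
    also have "(\<integral>\<^sup>+i. emeasure \<rho> (?B i) \<partial>count_space C) = emeasure \<rho> ?T"
      by (rule emeasure_UN_countable[symmetric]) (use C(1) disj sets in auto)
    also have "emeasure \<rho> ?T \<le> emeasure \<rho> U"
      using C(2) U(2) sets by (intro emeasure_mono) (auto simp: K_def)
    also have "\<dots> \<le> ennreal \<eta>" using U(3) by simp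
    also have "ennreal (2 * real (Suc n)) * ennreal \<eta> = ennreal e"
      using \<open>\<eta> > 0\<close> by (simp add: \<eta>_def del: of_nat_Suc flip: ennreal_mult)
    finally have le: "emeasure lborel ?T \<le> ennreal e"
      by (simp add: mult_left_mono)
    then have "emeasure lebesgue ?T \<le> ennreal e" using T by simp
    then have Tm: "?T \<in> lmeasurable" "measure lebesgue ?T \<le> e"
      using T \<open>e > 0\<close> by (auto simp: fmeasurable_def measure_def enn2real_leI top_unique less_top[symmetric])
    \<comment> \<open>The points missed by the Vitali family are negligible, so adding them to the
      cover does not raise the bound \<open>e\<close>.\<close>
    let ?R = "E n - ?T"
    have "?R \<in> lmeasurable" "measure lebesgue ?R = 0"
      using C(4) negligible_imp_measurable negligible_imp_measure0 by auto
    then have "?T \<union> ?R \<in> lmeasurable" "measure lebesgue (?T \<union> ?R) \<le> e"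
      using Tm measure_Un_le[of ?T lebesgue ?R] fmeasurable.Un[of ?T lebesgue ?R] by auto
    then show "\<exists>T. E n \<subseteq> T \<and> T \<in> lmeasurable \<and> measure lebesgue T \<le> e"
      by (intro exI[of _ "?T \<union> ?R"]) auto
  qed
  then have "negligible (\<Union>n. E n)" by (intro negligible_countable_Union) auto
  then have "(\<Union>n. E n) \<in> null_sets lebesgue" by (simp add: negligible_iff_null_sets)
  then have "AE x in lebesgue. x \<notin> (\<Union>n. E n)" by (rule AE_not_in)
  then have "AE x in lborel. x \<notin> (\<Union>n. E n)" by (simp add: AE_completion_iff)
  then show ?thesis
  proof eventually_elim
    case (elim x)
    show ?case
    proof (intro impI tendstoI)
      fix e :: real assume "x \<in> A" "e > 0"
      obtain n where n: "1 / real (Suc n) < e" using \<open>e > 0\<close> nat_approx_posE by metis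
      have "x \<notin> E n" using elim by auto
      then obtain d where d: "d > 0" "\<And>r. 0 < r \<Longrightarrow> r < d \<Longrightarrow> measure \<rho> (cball x r) \<le> r / real (Suc n)"
        unfolding E_def using \<open>x \<in> A\<close> by force
      have "\<forall>\<^sub>F r in at_right 0. 0 < r \<and> r < d"
        using d(1) by (auto simp: eventually_at_right_field)
      then show "\<forall>\<^sub>F r in at_right 0. dist (measure \<rho> (cball x r) / r) 0 < e"
      proof eventually_elim
        case (elim r)
        then have "measure \<rho> (cball x r) / r \<le> 1 / real (Suc n)"
          using d(2)[of r] by (simp add: field_simps)
        then show ?case using n elim by simp
      qed
    qed
  qed
qed

section \<open>The Poisson kernel on the line and its estimates in cones\<close>

definition poisson_line :: "complex \<Rightarrow> real \<Rightarrow> real" where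
  "poisson_line w t = (1 + t\<^sup>2) * Im w / (cmod (of_real t - w))\<^sup>2"

text \<open>For c <= 0 this set is empty and limits within it hold trivially, so the later limits
  range over all real c.\<close>

abbreviation stolz_cone :: "real \<Rightarrow> real \<Rightarrow> complex set" where
  "stolz_cone s c \<equiv> {w \<in> upper_half_plane. \<bar>Re w - s\<bar> < c * Im w}"

lemma poisson_line_altdef: "poisson_line w t = (1 + t\<^sup>2) * Im w / ((t - Re w)\<^sup>2 + (Im w)\<^sup>2)"
  by (simp add: poisson_line_def cmod_power2)

lemma poisson_line_nonneg: "Im w \<ge> 0 \<Longrightarrow> poisson_line w t \<ge> 0"
  by (simp add: poisson_line_def)

lemma borel_measurable_poisson_line [measurable]: "poisson_line w \<in> borel_measurable borel"
  unfolding poisson_line_altdef[abs_def] by measurable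

text \<open>The difference of the two sides is the square of t - 2s. Growth in t is traded for
  growth in t - s, which the denominator of the kernel absorbs.\<close>

lemma one_plus_square_le: "1 + t\<^sup>2 \<le> 1 + 2 * s\<^sup>2 + 2 * (t - s)\<^sup>2" for s t :: real
  using zero_le_power2[of "t - 2 * s"] by (simp add: power2_eq_square algebra_simps)

text \<open>The denominator absorbs the growth of the numerator. The bound is uniform in t, as
  integrability against finite measures requires, but it blows up as \<open>Im w\<close> tends to
  0.\<close>

lemma poisson_line_bounded:
  assumes "Im w > 0"
  shows "poisson_line w t \<le> ((1 + 2 * (Re w)\<^sup>2) / (Im w)\<^sup>2 + 2) * Im w"
proof -
  let ?x = "Re w" and ?y = "Im w"
  have "1 + t\<^sup>2 \<le> 1 + 2 * ?x\<^sup>2 + 2 * (t - ?x)\<^sup>2" by (rule one_plus_square_le)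
  also have "\<dots> \<le> ((1 + 2 * ?x\<^sup>2) / ?y\<^sup>2 + 2) * ((t - ?x)\<^sup>2 + ?y\<^sup>2)"
  proof -
    have "0 \<le> (1 + 2 * ?x\<^sup>2) / ?y\<^sup>2 * (t - ?x)\<^sup>2" by simp
    moreover have "(1 + 2 * ?x\<^sup>2) / ?y\<^sup>2 * ?y\<^sup>2 = 1 + 2 * ?x\<^sup>2" using assms by simp
    ultimately show ?thesis by (simp only: distrib_left distrib_right) simp
  qed
  finally have "(1 + t\<^sup>2) * ?y \<le> ((1 + 2 * ?x\<^sup>2) / ?y\<^sup>2 + 2) * ((t - ?x)\<^sup>2 + ?y\<^sup>2) * ?y"
    using assms by (intro mult_right_mono) auto
  moreover have "(t - ?x)\<^sup>2 + ?y\<^sup>2 > 0" using assms by (simp add: add_nonneg_pos)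
  ultimately show ?thesis
    unfolding poisson_line_altdef by (simp add: pos_divide_le_eq mult_ac)
qed

text \<open>This majorant turns estimates on masses of balls into estimates on Poisson integrals.
  Let k be least with |u| <= 2^k y. If k = 0, the kernel is at most 1/y; otherwise |u| > 2^(k-1) y
  and it is at most 1/(4^(k-1) y). Both are at most 4/(4^k y). Radii are cut at \<delta>, beyond
  which no mass estimate will be available.\<close>

lemma dyadic_kernel_bound:
  fixes u y \<delta> :: real
  assumes y: "0 < y" and u: "\<bar>u\<bar> \<le> \<delta>" and N: "\<delta> \<le> 2 ^ N * y"
  shows "y / (u\<^sup>2 + y\<^sup>2) \<le> (\<Sum>k\<le>N. 4 / (4 ^ k * y) * indicator {-(min \<delta> (2 ^ k * y))..min \<delta> (2 ^ k * y)} u)"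
proof -
  have ex: "\<bar>u\<bar> \<le> 2 ^ N * y" using u N by simp
  define k where "k = (LEAST k. \<bar>u\<bar> \<le> 2 ^ k * y)"
  have k: "\<bar>u\<bar> \<le> 2 ^ k * y" unfolding k_def by (rule LeastI[of _ N]) (rule ex)
  have "k \<le> N" unfolding k_def by (rule Least_le) (rule ex)
  have "y / (u\<^sup>2 + y\<^sup>2) \<le> 4 / (4 ^ k * y)"
  proof (cases k)
    case 0
    have "y / (u\<^sup>2 + y\<^sup>2) \<le> y / y\<^sup>2" using y by (intro divide_left_mono) (auto simp: add_nonneg_pos)
    also have "\<dots> \<le> 4 / y" using y by (simp add: power2_eq_square divide_right_mono)
    finally show ?thesis using 0 by simp
  next
    case (Suc j)
    then have "\<not> \<bar>u\<bar> \<le> 2 ^ j * y" unfolding k_def using not_less_Least[of j] by (metis lessI)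
    then have "(2 ^ j * y)\<^sup>2 \<le> u\<^sup>2" using y by (intro iffD1[OF abs_le_square_iff]) auto
    moreover have "(2 ^ j * y)\<^sup>2 = 4 ^ j * y\<^sup>2"
      using power_mult[of "2::real" 2 j] by (simp add: power_mult_distrib mult.commute flip: power_mult)
    ultimately have "4 ^ j * y\<^sup>2 \<le> u\<^sup>2 + y\<^sup>2" using zero_le_power2[of y] by linarith
    then have "y / (u\<^sup>2 + y\<^sup>2) \<le> y / (4 ^ j * y\<^sup>2)" using y by (intro divide_left_mono) (auto simp: add_nonneg_pos)
    also have "\<dots> = 4 / (4 ^ k * y)" using y Suc by (simp add: power2_eq_square field_simps)
    finally show ?thesis .
  qed
  also have "\<dots> = 4 / (4 ^ k * y) * indicator {-(min \<delta> (2 ^ k * y))..min \<delta> (2 ^ k * y)} u"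
    using k u by (auto simp: indicator_def)
  also have "\<dots> \<le> (\<Sum>k\<le>N. 4 / (4 ^ k * y) * indicator {-(min \<delta> (2 ^ k * y))..min \<delta> (2 ^ k * y)} u)"
    using y \<open>k \<le> N\<close> by (intro member_le_sum) auto
  finally show ?thesis .
qed

text \<open>In the cone, |t - s|^2 + (Im w)^2 is at most ((1 + c)^2 + 1) |t - w|^2, so w may be
  replaced by the point at height \<open>Im w\<close> directly above s. For |t - s| <= \<delta> the
  factor 1 + t^2 is at most 3 + 2 s^2 and the dyadic majorant applies; farther out the quotient is a
  bounded multiple of \<open>Im w\<close>.\<close>

lemma poisson_line_cone_bound:
  assumes w: "w \<in> stolz_cone s c" and \<delta>: "0 < \<delta>" "\<delta> \<le> 1" and N: "\<delta> \<le> 2 ^ N * Im w"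
  shows "poisson_line w t \<le> ((1 + c)\<^sup>2 + 1) * ((3 + 2 * s\<^sup>2) *
     (\<Sum>k\<le>N. 4 / (4 ^ k * Im w) * indicator (cball s (min \<delta> (2 ^ k * Im w))) t) +
     ((1 + 2 * s\<^sup>2) / \<delta>\<^sup>2 + 2) * Im w)"
proof -
  let ?x = "Re w" and ?y = "Im w"
  have y: "?y > 0" and c: "\<bar>?x - s\<bar> < c * ?y" using w by (auto simp: upper_half_plane_def)
  \<comment> \<open>The cone contains w, which forces c > 0.\<close>
  have "0 < c * ?y" using c by linarith
  then have "c > 0" using y by (rule zero_less_mult_pos2)
  let ?C = "(1 + c)\<^sup>2 + 1"
  define S where "S = (\<Sum>k\<le>N. 4 / (4 ^ k * ?y) * indicator (cball s (min \<delta> (2 ^ k * ?y))) t :: real)"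
  have "S \<ge> 0" unfolding S_def using y by (intro sum_nonneg) auto
  \<comment> \<open>\<open>r\<close> is the distance |t - w|; it dominates both |t - Re w| and
    \<open>Im w\<close>, hence |t - s| <= (1 + c) r.\<close>
  define r where "r = sqrt ((t - ?x)\<^sup>2 + ?y\<^sup>2)"
  have r2: "r\<^sup>2 = (t - ?x)\<^sup>2 + ?y\<^sup>2" by (simp add: r_def)
  have r: "\<bar>t - ?x\<bar> \<le> r" "?y \<le> r" unfolding r_def using y by (auto intro!: real_le_rsqrt real_sqrt_ge_abs1)
  have "\<bar>t - s\<bar> \<le> r + c * ?y" using r c by simp
  also have "\<dots> \<le> (1 + c) * r" using r \<open>c > 0\<close> by (simp add: distrib_right)
  finally have "(t - s)\<^sup>2 \<le> ((1 + c) * r)\<^sup>2" using \<open>c > 0\<close> r y by (intro iffD1[OF abs_le_square_iff]) auto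
  moreover have "?y\<^sup>2 \<le> r\<^sup>2" using r y by (intro power_mono) auto
  ultimately have *: "(t - s)\<^sup>2 + ?y\<^sup>2 \<le> ?C * r\<^sup>2"
    unfolding power_mult_distrib distrib_right[of _ _ "r\<^sup>2"] mult_1 by linarith
  have pos: "0 < (t - s)\<^sup>2 + ?y\<^sup>2" "0 < r\<^sup>2" using y r by (auto simp: add_nonneg_pos)
  have "1 / r\<^sup>2 \<le> ?C / ((t - s)\<^sup>2 + ?y\<^sup>2)" using * pos by (simp add: field_simps)
  then have "(1 + t\<^sup>2) * ?y * (1 / r\<^sup>2) \<le> (1 + t\<^sup>2) * ?y * (?C / ((t - s)\<^sup>2 + ?y\<^sup>2))"
    using y by (intro mult_left_mono) auto
  then have "poisson_line w t \<le> ?C * ((1 + t\<^sup>2) * (?y / ((t - s)\<^sup>2 + ?y\<^sup>2)))"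
    unfolding poisson_line_altdef r2 by (simp add: mult_ac)
  also have "(1 + t\<^sup>2) * (?y / ((t - s)\<^sup>2 + ?y\<^sup>2)) \<le> (3 + 2 * s\<^sup>2) * S + ((1 + 2 * s\<^sup>2) / \<delta>\<^sup>2 + 2) * ?y"
  proof (cases "\<bar>t - s\<bar> \<le> \<delta>")
    case True
    have eq: "indicator (cball s (min \<delta> (2 ^ k * ?y))) t =
        (indicator {-(min \<delta> (2 ^ k * ?y))..min \<delta> (2 ^ k * ?y)} (t - s) :: real)" for k
      by (auto simp: indicator_def dist_real_def)
    have "(t - s)\<^sup>2 \<le> 1" using True \<delta> by (simp add: abs_square_le_1)
    then have "1 + t\<^sup>2 \<le> 3 + 2 * s\<^sup>2" using one_plus_square_le[of t s] by simp
    moreover have "?y / ((t - s)\<^sup>2 + ?y\<^sup>2) \<le> S"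
      unfolding S_def eq by (rule dyadic_kernel_bound[OF y True N])
    ultimately have "(1 + t\<^sup>2) * (?y / ((t - s)\<^sup>2 + ?y\<^sup>2)) \<le> (3 + 2 * s\<^sup>2) * S"
      using y by (intro mult_mono) auto
    moreover have "0 \<le> ((1 + 2 * s\<^sup>2) / \<delta>\<^sup>2 + 2) * ?y" using y by simp
    ultimately show ?thesis by linarith
  next
    case False
    then have d2: "\<delta>\<^sup>2 \<le> (t - s)\<^sup>2" using \<delta> by (intro iffD1[OF abs_le_square_iff]) auto
    have "(1 + t\<^sup>2) \<le> (1 + 2 * s\<^sup>2) + 2 * (t - s)\<^sup>2" by (rule one_plus_square_le)
    also have "1 + 2 * s\<^sup>2 = (1 + 2 * s\<^sup>2) / \<delta>\<^sup>2 * \<delta>\<^sup>2" using \<delta> by simp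
    also have "(1 + 2 * s\<^sup>2) / \<delta>\<^sup>2 * \<delta>\<^sup>2 \<le> (1 + 2 * s\<^sup>2) / \<delta>\<^sup>2 * (t - s)\<^sup>2"
      using d2 by (intro mult_left_mono) auto
    finally have "1 + t\<^sup>2 \<le> ((1 + 2 * s\<^sup>2) / \<delta>\<^sup>2 + 2) * (t - s)\<^sup>2" by (simp add: distrib_right)
    also have "\<dots> \<le> ((1 + 2 * s\<^sup>2) / \<delta>\<^sup>2 + 2) * ((t - s)\<^sup>2 + ?y\<^sup>2)"
      by (intro mult_left_mono) auto
    finally have "(1 + t\<^sup>2) * ?y \<le> ((1 + 2 * s\<^sup>2) / \<delta>\<^sup>2 + 2) * ((t - s)\<^sup>2 + ?y\<^sup>2) * ?y"
      using y by (intro mult_right_mono) auto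
    then have "(1 + t\<^sup>2) * (?y / ((t - s)\<^sup>2 + ?y\<^sup>2)) \<le> ((1 + 2 * s\<^sup>2) / \<delta>\<^sup>2 + 2) * ?y"
      using pos by (simp add: pos_divide_le_eq mult_ac)
    moreover have "0 \<le> (3 + 2 * s\<^sup>2) * S" using \<open>S \<ge> 0\<close> by simp
    ultimately show ?thesis by linarith
  qed
  finally show ?thesis unfolding S_def by (simp add: mult_left_mono)
qed

lemma poisson_integral_tendsto_0:
  fixes \<rho> :: "real measure"
  assumes fin: "finite_measure \<rho>" and sets: "sets \<rho> = sets borel"
    and lim: "((\<lambda>r. measure \<rho> (cball s r) / r) \<longlongrightarrow> 0) (at_right 0)"
  shows "((\<lambda>w. \<integral>t. poisson_line w t \<partial>\<rho>) \<longlongrightarrow> 0) (at (of_real s) within stolz_cone s c)"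
proof (rule tendstoI)
  fix e :: real assume "e > 0"
  interpret finite_measure \<rho> by fact
  have sets' [measurable_cong]: "sets \<rho> = sets borel" by fact
  define C where "C = (1 + c)\<^sup>2 + 1"
  define M1 where "M1 = 3 + 2 * s\<^sup>2"
  have "C > 0" "M1 > 0" by (auto simp: C_def M1_def add_nonneg_pos add_pos_nonneg)
  \<comment> \<open>The dyadic sum will be at most \<open>8 * \<epsilon>\<close>, so the near part
    contributes at most e/2; the far part vanishes with \<open>Im w\<close>.\<close>
  define \<epsilon> where "\<epsilon> = e / (16 * C * M1)"
  have "\<epsilon> > 0" using \<open>e > 0\<close> \<open>C > 0\<close> \<open>M1 > 0\<close> by (simp add: \<epsilon>_def)
  have "\<forall>\<^sub>F r in at_right 0. dist (measure \<rho> (cball s r) / r) 0 < \<epsilon>"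
    using lim \<open>\<epsilon> > 0\<close> by (rule tendstoD)
  then obtain d where d: "d > 0" "\<And>r. 0 < r \<Longrightarrow> r < d \<Longrightarrow> measure \<rho> (cball s r) / r < \<epsilon>"
    by (auto simp: eventually_at_right_field abs_less_iff)
  \<comment> \<open>Halving \<open>d\<close> makes r <= \<delta> imply the strict r < d; the cap 1
    is required by the cone bound.\<close>
  define \<delta> where "\<delta> = min 1 (d / 2)"
  have \<delta>: "0 < \<delta>" "\<delta> \<le> 1" "\<delta> < d" using d(1) by (auto simp: \<delta>_def)
  have small: "measure \<rho> (cball s r) \<le> \<epsilon> * r" if "0 < r" "r \<le> \<delta>" for r
    using d(2)[of r] that \<delta> by (simp add: field_simps)
  define M2 where "M2 = (1 + 2 * s\<^sup>2) / \<delta>\<^sup>2 + 2"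
  have "M2 > 0" by (auto simp: M2_def add_nonneg_pos)
  define m where "m = measure \<rho> UNIV"
  have sp: "space \<rho> = UNIV" using sets_eq_imp_space_eq[OF sets] by simp
  have bound: "norm (\<integral>t. poisson_line w t \<partial>\<rho>) \<le> C * (M1 * (8 * \<epsilon>) + M2 * Im w * m)"
    if w: "w \<in> stolz_cone s c" for w
  proof -
    let ?y = "Im w"
    have y: "?y > 0" using w by (simp add: upper_half_plane_def)
    \<comment> \<open>\<open>N\<close> grows as w approaches the boundary, but the final bound is
      free of it: mass at most \<open>\<epsilon> * (2 ^ k * ?y)\<close> against weight
      \<open>4 / (4 ^ k * ?y)\<close> leaves a geometric series.\<close>
    obtain N where "\<delta> / ?y < 2 ^ N" using real_arch_pow[of 2 "\<delta> / ?y"] by auto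
    then have N: "\<delta> \<le> 2 ^ N * ?y" using y by (simp add: field_simps)
    let ?b = "\<lambda>k. min \<delta> (2 ^ k * ?y)"
    let ?G = "\<lambda>t. C * (M1 * (\<Sum>k\<le>N. 4 / (4 ^ k * ?y) * indicator (cball s (?b k)) t) + M2 * ?y)"
    have [simp]: "integrable \<rho> (\<lambda>t. indicator (cball s r) t :: real)" for r
      by (intro integrable_real_indicator) (auto simp: emeasure_eq_measure sets)
    have int: "integrable \<rho> ?G" by simp
    have "(\<integral>t. poisson_line w t \<partial>\<rho>) \<le> (\<integral>t. ?G t \<partial>\<rho>)"
    proof (rule integral_mono'[OF int])
      show le: "poisson_line w t \<le> ?G t" for t
        using poisson_line_cone_bound[OF w \<delta>(1,2) N, of t] by (simp add: C_def M1_def M2_def)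
      show "0 \<le> ?G t" for t
        using le[of t] poisson_line_nonneg[of w t] y by simp
    qed
    also have "(\<integral>t. ?G t \<partial>\<rho>) = C * (M1 * (\<Sum>k\<le>N. 4 / (4 ^ k * ?y) * measure \<rho> (cball s (?b k))) + M2 * ?y * m)"
      by (simp add: sets sp m_def integral_sum)
    also have "\<dots> \<le> C * (M1 * (8 * \<epsilon>) + M2 * ?y * m)"
    proof -
      have "(\<Sum>k\<le>N. 4 / (4 ^ k * ?y) * measure \<rho> (cball s (?b k))) \<le> (\<Sum>k\<le>N. 4 * \<epsilon> * (1/2) ^ k)"
      proof (rule sum_mono)
        fix k
        have "measure \<rho> (cball s (?b k)) \<le> \<epsilon> * ?b k" using y \<delta> by (intro small) auto
        also have "\<dots> \<le> \<epsilon> * (2 ^ k * ?y)" using \<open>\<epsilon> > 0\<close> by (intro mult_left_mono) auto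
        finally have "4 / (4 ^ k * ?y) * measure \<rho> (cball s (?b k)) \<le> 4 / (4 ^ k * ?y) * (\<epsilon> * (2 ^ k * ?y))"
          using y by (intro mult_left_mono) auto
        also have "\<dots> = 4 * \<epsilon> * (2 ^ k / 4 ^ k)" using y by simp
        also have "2 ^ k / 4 ^ k = (1/2::real) ^ k" by (simp flip: power_divide)
        finally show "4 / (4 ^ k * ?y) * measure \<rho> (cball s (?b k)) \<le> 4 * \<epsilon> * (1/2) ^ k" .
      qed
      also have "\<dots> = 4 * \<epsilon> * (\<Sum>k\<le>N. (1/2) ^ k)" by (simp add: sum_distrib_left)
      also have "(\<Sum>k\<le>N. (1/2::real) ^ k) \<le> 2"
        by (simp add: sum_gp0 del: sum.atMost_Suc)
      finally have "(\<Sum>k\<le>N. 4 / (4 ^ k * ?y) * measure \<rho> (cball s (?b k))) \<le> 8 * \<epsilon>"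
        using \<open>\<epsilon> > 0\<close> by simp
      then show ?thesis using \<open>C > 0\<close> \<open>M1 > 0\<close> by (intro mult_left_mono add_right_mono) auto
    qed
    finally show ?thesis using poisson_line_nonneg[of w] y by (simp add: abs_of_nonneg)
  qed
  have "((\<lambda>w. C * (M1 * (8 * \<epsilon>) + M2 * Im w * m)) \<longlongrightarrow> C * (M1 * (8 * \<epsilon>) + M2 * Im (of_real s) * m))
      (at (of_real s) within stolz_cone s c)"
    by (intro tendsto_intros)
  moreover have "C * (M1 * (8 * \<epsilon>) + M2 * Im (of_real s) * m) < e"
    using \<open>e > 0\<close> \<open>C > 0\<close> \<open>M1 > 0\<close> by (simp add: \<epsilon>_def)
  ultimately have "\<forall>\<^sub>F w in at (of_real s) within stolz_cone s c. C * (M1 * (8 * \<epsilon>) + M2 * Im w * m) < e"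
    by (rule order_tendstoD)
  moreover have "\<forall>\<^sub>F w in at (of_real s) within stolz_cone s c. w \<in> stolz_cone s c"
    by (auto simp: eventually_at_filter)
  ultimately show "\<forall>\<^sub>F w in at (of_real s) within stolz_cone s c. dist (\<integral>t. poisson_line w t \<partial>\<rho>) 0 < e"
    by eventually_elim (use bound in fastforce)
qed

lemma poisson_integral_AE_tendsto_0:
  fixes \<rho> :: "real measure"
  assumes "finite_measure \<rho>" "sets \<rho> = sets borel" "A \<in> sets borel" "emeasure \<rho> A = 0"
  shows "AE s in lborel. s \<in> A \<longrightarrow>
    (\<forall>c. ((\<lambda>w. \<integral>t. poisson_line w t \<partial>\<rho>) \<longlongrightarrow> 0) (at (of_real s) within stolz_cone s c))"
  using null_set_derivative_zero[OF assms]
  by eventually_elim (use poisson_integral_tendsto_0[OF assms(1,2)] in blast)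

section \<open>Total mass of the kernel and Fatou's theorem for scalar measures\<close>

lemma has_bochner_integral_cauchy_kernel:
  fixes x y :: real
  assumes y: "0 < y"
  shows "has_bochner_integral lborel (\<lambda>t. y / ((t - x)\<^sup>2 + y\<^sup>2)) pi"
proof -
  let ?f = "\<lambda>t. y / ((t - x)\<^sup>2 + y\<^sup>2)" and ?F = "\<lambda>t. arctan ((t - x) / y)"
  have pos: "(t - x)\<^sup>2 + y\<^sup>2 > 0" for t using y by (simp add: add_nonneg_pos)
  have top: "filterlim (\<lambda>t. (t - x) / y) at_top at_top"
    using y by real_asymp
  have bot: "filterlim (\<lambda>t. (t - x) / y) at_bot at_bot"
    using y by real_asymp
  have D: "(?F has_real_derivative ?f t) (at t)" for t
    using y pos[of t] by (auto intro!: derivative_eq_intros simp: power2_eq_square field_simps)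
  have C: "isCont ?f t" for t
    using pos[of t] by (intro continuous_intros) auto
  have lims: "((?F \<circ> real_of_ereal) \<longlongrightarrow> - (pi / 2)) (at_right (-\<infinity>))" "((?F \<circ> real_of_ereal) \<longlongrightarrow> pi / 2) (at_left \<infinity>)"
    unfolding ereal_tendsto_simps
    by (intro filterlim_compose[OF tendsto_arctan_at_top top] filterlim_compose[OF tendsto_arctan_at_bot bot])+
  have nonneg: "AE t in lborel. -\<infinity> < ereal t \<longrightarrow> ereal t < \<infinity> \<longrightarrow> 0 \<le> ?f t"
    using y by simp
  \<comment> \<open>For a nonnegative integrand the improper fundamental theorem yields
    integrability together with the value.\<close>
  note FTC = interval_integral_FTC_nonneg[of "-\<infinity>" \<infinity> ?F ?f, OF _ D C nonneg lims, simplified]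
  show ?thesis
    using FTC by (simp add: has_bochner_integral_iff interval_lebesgue_integral_def set_integrable_def set_lebesgue_integral_def)
qed

text \<open>The weight cancels the factor 1 + t^2 and leaves the Cauchy kernel, of integral pi.
  Multiples of the weight are the comparison densities in Fatou's theorem.\<close>

lemma has_bochner_integral_poisson_line:
  assumes "Im w > 0"
  shows "has_bochner_integral lborel (\<lambda>t. 1 / (pi * (1 + t\<^sup>2)) * poisson_line w t) 1"
proof -
  have nz: "1 + t\<^sup>2 \<noteq> 0" for t :: real by (metis add_pos_nonneg less_numeral_extra(1) less_numeral_extra(3) zero_le_power2)
  have "has_bochner_integral lborel (\<lambda>t. 1 / pi * (Im w / ((t - Re w)\<^sup>2 + (Im w)\<^sup>2))) (1 / pi * pi)"
    by (intro has_bochner_integral_mult_right has_bochner_integral_cauchy_kernel assms)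
  moreover have "1 / pi * (Im w / ((t - Re w)\<^sup>2 + (Im w)\<^sup>2)) = 1 / (pi * (1 + t\<^sup>2)) * poisson_line w t" for t
    unfolding poisson_line_altdef using nz[of t] by simp
  ultimately show ?thesis by simp
qed

lemma integrable_mult_poisson_line:
  fixes f :: "real \<Rightarrow> real"
  assumes f: "integrable M f" and sets: "sets M = sets borel" and w: "Im w > 0"
  shows "integrable M (\<lambda>t. f t * poisson_line w t)"
proof -
  have [measurable_cong]: "sets M = sets borel" by fact
  have [measurable]: "f \<in> borel_measurable M" using f by simp
  define C where "C = ((1 + 2 * (Re w)\<^sup>2) / (Im w)\<^sup>2 + 2) * Im w"
  have "integrable M (\<lambda>t. C * f t)" using f by simp
  then show ?thesis
  proof (rule Bochner_Integration.integrable_bound)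
    show "AE t in M. norm (f t * poisson_line w t) \<le> norm (C * f t)"
    proof (intro AE_I2)
      fix t
      have "0 \<le> poisson_line w t" "poisson_line w t \<le> C"
        using poisson_line_bounded[OF w] poisson_line_nonneg[of w] w by (auto simp: C_def)
      then show "norm (f t * poisson_line w t) \<le> norm (C * f t)"
        using mult_right_mono[of "poisson_line w t" C "\<bar>f t\<bar>"] by (simp add: abs_mult mult.commute)
    qed
  qed measurable
qed

text \<open>Testing on the set where f is negative shows that the negative part has integral
  0.\<close>

lemma AE_nonneg_of_set_integral_nonneg:
  fixes f :: "'a \<Rightarrow> real"
  assumes f: "integrable M f" and nonneg: "\<And>A. A \<in> sets M \<Longrightarrow> 0 \<le> (LINT x:A|M. f x)"
  shows "AE x in M. 0 \<le> f x"
proof -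
  have [measurable]: "f \<in> borel_measurable M" using f by simp
  let ?A = "{x\<in>space M. f x < 0}"
  have A: "?A \<in> sets M" by measurable
  have int: "integrable M (\<lambda>x. - (indicator ?A x * f x))"
    using integrable_mult_indicator[OF A f] by simp
  have "(\<integral>x. - (indicator ?A x * f x) \<partial>M) = - (LINT x:?A|M. f x)"
    by (simp add: set_lebesgue_integral_def)
  also have "\<dots> \<le> 0" using nonneg[OF A] by simp
  finally have le: "(\<integral>x. - (indicator ?A x * f x) \<partial>M) \<le> 0" .
  have pos: "AE x in M. 0 \<le> - (indicator ?A x * f x)" by (intro AE_I2) (auto simp: indicator_def)
  have "(\<integral>x. - (indicator ?A x * f x) \<partial>M) = 0"
    using le integral_nonneg_AE[OF pos] by linarith
  then have "AE x in M. - (indicator ?A x * f x) = 0"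
    using integral_nonneg_eq_0_iff_AE[OF int pos] by blast
  moreover have "AE x in M. x \<in> space M" by simp
  ultimately show ?thesis
    by eventually_elim (auto simp: indicator_def split: if_splits)
qed

text \<open>The finite measure with density \<open>max 0 h\<close> does not charge the set where h
  <= 0, so the result on uncharged sets applies there.\<close>

lemma poisson_integral_positive_part_AE_tendsto_0:
  fixes h :: "real \<Rightarrow> real"
  assumes h: "integrable lborel h"
  shows "AE s in lborel. h s \<le> 0 \<longrightarrow>
    (\<forall>c. ((\<lambda>w. LBINT t. max 0 (h t) * poisson_line w t) \<longlongrightarrow> 0) (at (of_real s) within stolz_cone s c))"
proof -
  have [measurable]: "h \<in> borel_measurable borel" using h by simp
  let ?D = "density lborel (\<lambda>t. ennreal (max 0 (h t)))"
  have int: "integrable lborel (\<lambda>t. max 0 (h t))" using h by simp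
  have "emeasure ?D UNIV \<noteq> \<infinity>"
    using nn_integral_eq_integral[OF int] by (simp add: emeasure_density)
  then have fin: "finite_measure ?D" by (intro finite_measureI) simp
  have A: "{s. h s \<le> 0} \<in> sets borel" by measurable
  have "emeasure ?D {s. h s \<le> 0} = (\<integral>\<^sup>+t. ennreal (max 0 (h t)) * indicator {s. h s \<le> 0} t \<partial>lborel)"
    by (rule emeasure_density) (use A in auto)
  also have "\<dots> = (\<integral>\<^sup>+t. 0 \<partial>(lborel :: real measure))"
    by (rule nn_integral_cong) (auto split: split_indicator)
  finally have "emeasure ?D {s. h s \<le> 0} = 0" by simp
  moreover have "(\<integral>t. poisson_line w t \<partial>?D) = (LBINT t. max 0 (h t) * poisson_line w t)" for w
    by (subst integral_density) auto
  ultimately show ?thesis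
    using poisson_integral_AE_tendsto_0[OF fin _ A] by simp
qed

text \<open>Comparing the absolutely continuous part with \<open>q / (pi * (1 + t\<^sup>2))\<close>, whose Poisson integral
  is the constant \<open>q\<close>, for all rational \<open>q\<close> reduces the theorem to null sets of measures and
  makes Lebesgue points unnecessary.\<close>

theorem fatou_line:
  fixes N :: "real measure" and f :: "real \<Rightarrow> real"
  assumes fin: "finite_measure N" and sets: "sets N = sets borel"
    and Z: "Z \<in> null_sets lborel" and f: "integrable lborel f"
    and N: "\<And>\<Omega>. \<Omega> \<in> sets borel \<Longrightarrow> \<Omega> \<inter> Z = {} \<Longrightarrow> measure N \<Omega> = (LBINT t:\<Omega>. f t)"
  shows "AE s in lborel. \<forall>c. ((\<lambda>w. \<integral>t. poisson_line w t \<partial>N) \<longlongrightarrow> pi * (1 + s\<^sup>2) * f s)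
    (at (of_real s) within stolz_cone s c)"
proof -
  interpret finite_measure N by fact
  have sets' [measurable_cong]: "sets N = sets borel" by fact
  have sp: "space N = UNIV" using sets_eq_imp_space_eq[OF sets] by simp
  have Zb [measurable]: "Z \<in> sets borel" using Z by auto
  have [measurable]: "f \<in> borel_measurable borel" using f by simp
  have AEZ: "AE t in lborel. t \<notin> Z" using Z by (rule AE_not_in)
  \<comment> \<open>Removing the Lebesgue null set \<open>Z\<close> changes no integral of f, so the
    hypothesis on N identifies f as the density of N off \<open>Z\<close>. This yields f >= 0 almost
    everywhere and the equality \<open>ac\<close> of measures.\<close>
  have minus_Z: "(LBINT t:\<Omega>. f t) = measure N (\<Omega> - Z)" if [measurable]: "\<Omega> \<in> sets borel" for \<Omega>
  proof -
    have "(LBINT t:\<Omega>. f t) = (LBINT t:\<Omega> - Z. f t)"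
      unfolding set_lebesgue_integral_def
      by (rule integral_cong_AE) (use AEZ in \<open>auto simp: indicator_def elim!: eventually_mono\<close>)
    moreover have "measure N (\<Omega> - Z) = (LBINT t:\<Omega> - Z. f t)" by (rule N) auto
    ultimately show ?thesis by simp
  qed
  have f0: "AE t in lborel. 0 \<le> f t"
    by (rule AE_nonneg_of_set_integral_nonneg[OF f]) (simp add: minus_Z)
  have ac: "density N (indicator (- Z)) = density lborel (\<lambda>t. ennreal (f t))"
  proof (rule measure_eqI)
    fix \<Omega> assume "\<Omega> \<in> sets (density N (indicator (- Z)))"
    then have [measurable]: "\<Omega> \<in> sets borel" by (simp add: sets)
    have "emeasure (density N (indicator (- Z))) \<Omega> = emeasure N (\<Omega> - Z)"
      by (subst emeasure_density) (auto simp: sets simp flip: indicator_inter_arith nn_integral_indicator intro!: nn_integral_cong split: split_indicator)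
    also have "\<dots> = ennreal (LBINT t:\<Omega>. f t)" by (simp add: emeasure_eq_measure minus_Z)
    also have "\<dots> = (\<integral>\<^sup>+t. ennreal (indicator \<Omega> t * f t) \<partial>lborel)"
      unfolding set_lebesgue_integral_def real_scaleR_def
      by (rule nn_integral_eq_integral[symmetric])
         (use f0 integrable_mult_indicator[OF _ f, of \<Omega>] in \<open>auto simp: indicator_def elim!: eventually_mono\<close>)
    also have "\<dots> = emeasure (density lborel (\<lambda>t. ennreal (f t))) \<Omega>"
      by (subst emeasure_density) (auto intro!: nn_integral_cong split: split_indicator)
    finally show "emeasure (density N (indicator (- Z))) \<Omega> = emeasure (density lborel (\<lambda>t. ennreal (f t))) \<Omega>" .
  qed (simp add: sets)
  let ?S = "density N (indicator Z)"
  let ?PS = "\<lambda>w. \<integral>t. poisson_line w t \<partial>?S"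
  let ?q = "\<lambda>q t. q * (1 / (pi * (1 + t\<^sup>2)))"
  let ?Pu = "\<lambda>q w. LBINT t. max 0 (f t - ?q q t) * poisson_line w t"
  let ?Pl = "\<lambda>q w. LBINT t. max 0 (?q q t - f t) * poisson_line w t"
  have m0: "integrable lborel (?q q)" for q
  proof -
    have "has_bochner_integral lborel (\<lambda>t. q / pi * (1 / ((t - 0)\<^sup>2 + 1\<^sup>2))) (q / pi * pi)"
      by (intro has_bochner_integral_mult_right has_bochner_integral_cauchy_kernel) simp
    then show ?thesis by (simp add: has_bochner_integral_iff add.commute)
  qed
  \<comment> \<open>Off \<open>Z\<close>, f is the comparison density plus the positive part minus
    the negative part of their difference, and the comparison density has Poisson integral q. The
    identity holds for every q, so q can later be chosen close to the limit.\<close>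
  have split: "(\<integral>t. poisson_line w t \<partial>N) = ?PS w + (q + (?Pu q w - ?Pl q w))" if w: "Im w > 0" for w q
  proof -
    have int1: "integrable N (\<lambda>t. poisson_line w t)"
      using integrable_mult_poisson_line[of N "\<lambda>_. 1", OF _ sets w] by simp
    have intZ: "integrable N (\<lambda>t. indicator A t * poisson_line w t)" if "A \<in> sets borel" for A
      using integrable_mult_indicator[OF _ int1, of A] that by (simp add: sets)
    have "(\<integral>t. poisson_line w t \<partial>N) = (\<integral>t. indicator Z t * poisson_line w t + indicator (-Z) t * poisson_line w t \<partial>N)"
      by (rule Bochner_Integration.integral_cong) (auto split: split_indicator)
    also have "\<dots> = (\<integral>t. indicator Z t * poisson_line w t \<partial>N) + (\<integral>t. indicator (-Z) t * poisson_line w t \<partial>N)"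
      by (intro Bochner_Integration.integral_add intZ) auto
    also have "(\<integral>t. indicator Z t * poisson_line w t \<partial>N) = ?PS w"
      using integral_density[of "poisson_line w" N "indicator Z"] by (simp add: ennreal_indicator)
    also have "(\<integral>t. indicator (-Z) t * poisson_line w t \<partial>N) = (\<integral>t. poisson_line w t \<partial>density N (indicator (-Z)))"
      using integral_density[of "poisson_line w" N "indicator (-Z)"] by (simp add: ennreal_indicator)
    also have "\<dots> = (LBINT t. f t * poisson_line w t)"
      unfolding ac using f0 by (subst integral_density) auto
    also have "\<dots> = (LBINT t. ?q q t * poisson_line w t +
        (max 0 (f t - ?q q t) * poisson_line w t - max 0 (?q q t - f t) * poisson_line w t))"
      by (rule Bochner_Integration.integral_cong) (auto simp: max_def algebra_simps)
    also have "\<dots> = (LBINT t. ?q q t * poisson_line w t) + (?Pu q w - ?Pl q w)"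
      by (subst Bochner_Integration.integral_add Bochner_Integration.integral_diff,
          (intro Bochner_Integration.integrable_diff integrable_mult_poisson_line
            integrable_max integrable_zero f m0 w sets_lborel)+)+ simp
    also have "(LBINT t. ?q q t * poisson_line w t) = q"
      using has_bochner_integral_mult_right[OF has_bochner_integral_poisson_line[OF w], of q]
      by (simp add: has_bochner_integral_iff mult.assoc)
    finally show ?thesis .
  qed
  have finS: "finite_measure ?S"
    by (intro finite_measureI) (simp add: emeasure_density sp nn_integral_indicator sets emeasure_eq_measure)
  have S0: "AE s in lborel. s \<in> - Z \<longrightarrow> (\<forall>c. (?PS \<longlongrightarrow> 0) (at (of_real s) within stolz_cone s c))"
  proof (rule poisson_integral_AE_tendsto_0[OF finS])
    have "emeasure ?S (- Z) = (\<integral>\<^sup>+t. indicator Z t * indicator (- Z) t \<partial>N)"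
      by (rule emeasure_density) (auto simp: sets)
    also have "\<dots> = (\<integral>\<^sup>+t. 0 \<partial>N)"
      by (rule nn_integral_cong) (auto split: split_indicator)
    finally show "emeasure ?S (- Z) = 0" by simp
  qed (auto simp: sets)
  \<comment> \<open>Rational q keep the exceptional null sets countable in number and are dense
    enough for the squeeze below.\<close>
  have up: "AE s in lborel. \<forall>q::rat. f s - ?q (of_rat q) s \<le> 0 \<longrightarrow>
      (\<forall>c. (?Pu (of_rat q) \<longlongrightarrow> 0) (at (of_real s) within stolz_cone s c))"
    unfolding AE_all_countable
    by (intro allI poisson_integral_positive_part_AE_tendsto_0 Bochner_Integration.integrable_diff f m0)
  have lo: "AE s in lborel. \<forall>q::rat. ?q (of_rat q) s - f s \<le> 0 \<longrightarrow>
      (\<forall>c. (?Pl (of_rat q) \<longlongrightarrow> 0) (at (of_real s) within stolz_cone s c))"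
    unfolding AE_all_countable
    by (intro allI poisson_integral_positive_part_AE_tendsto_0 Bochner_Integration.integrable_diff f m0)
  show ?thesis
    using AEZ S0 up lo
  proof eventually_elim
    case (elim s)
    show ?case
    proof
      fix c
      let ?F = "at (of_real s) within stolz_cone s c"
      let ?g = "pi * (1 + s\<^sup>2) * f s"
      have pos: "pi * (1 + s\<^sup>2) > 0" by (simp add: add_pos_nonneg)
      have S: "(?PS \<longlongrightarrow> 0) ?F" using elim(1,2) by blast
      have ev: "\<forall>\<^sub>F w in ?F. Im w > 0" by (auto simp: eventually_at_filter upper_half_plane_def)
      have nn: "?PS w \<ge> 0" "?Pu q w \<ge> 0" "?Pl q w \<ge> 0" if "Im w > 0" for w q
        using that by (auto intro!: integral_nonneg_AE AE_I2 mult_nonneg_nonneg simp: poisson_line_nonneg)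
      show "((\<lambda>w. \<integral>t. poisson_line w t \<partial>N) \<longlongrightarrow> ?g) ?F"
      proof (rule order_tendstoI)
        fix a assume "a < ?g"
        \<comment> \<open>Here \<open>?q (of_rat q) s < f s\<close>, so \<open>?Pl\<close> tends to
          0 at s. Dropping the nonnegative terms \<open>?PS\<close> and \<open>?Pu\<close> leaves
          the lower bound q - \<open>?Pl\<close>, eventually above a.\<close>
        then obtain q where q: "a < of_rat q" "of_rat q < ?g" using of_rat_dense by blast
        then have "?q (of_rat q) s - f s \<le> 0" using pos by (simp add: field_simps)
        with elim(4) have "(?Pl (of_rat q) \<longlongrightarrow> 0) ?F" by blast
        moreover have "0 < of_rat q - a" using q by simp
        ultimately have "\<forall>\<^sub>F w in ?F. ?Pl (of_rat q) w < of_rat q - a" by (rule order_tendstoD)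
        with ev show "\<forall>\<^sub>F w in ?F. a < (\<integral>t. poisson_line w t \<partial>N)"
        proof eventually_elim
          case (elim w)
          then show ?case using nn(1)[of w] nn(2)[of w "of_rat q"] split[of w "of_rat q"] by linarith
        qed
      next
        fix a assume "?g < a"
        then obtain q where q: "?g < of_rat q" "of_rat q < a" using of_rat_dense by blast
        then have "f s - ?q (of_rat q) s \<le> 0" using pos by (simp add: field_simps)
        with elim(3) have "(?Pu (of_rat q) \<longlongrightarrow> 0) ?F" by blast
        with S have "((\<lambda>w. ?PS w + ?Pu (of_rat q) w) \<longlongrightarrow> 0 + 0) ?F" by (intro tendsto_add)
        moreover have "0 + 0 < a - of_rat q" using q by simp
        ultimately have "\<forall>\<^sub>F w in ?F. ?PS w + ?Pu (of_rat q) w < a - of_rat q" by (rule order_tendstoD)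
        with ev show "\<forall>\<^sub>F w in ?F. (\<integral>t. poisson_line w t \<partial>N) < a"
        proof eventually_elim
          case (elim w)
          then show ?case using nn(3)[of w "of_rat q"] split[of w "of_rat q"] by linarith
        qed
      qed
    qed
  qed
qed

section \<open>Matrices and matrix measures\<close>

lemma cadjoint_nth [simp]: "cadjoint A $ i $ j = cnj (A $ j $ i)"
  by (simp add: cadjoint_def)

lemma cadjoint_mult: "cadjoint (A ** B) = cadjoint B ** cadjoint A"
  by (simp add: vec_eq_iff matrix_matrix_mult_def mult.commute)

lemma cadjoint_diff: "cadjoint (A - B) = cadjoint A - cadjoint B"
  by (simp add: vec_eq_iff)

lemma cadjoint_mat_1 [simp]: "cadjoint (mat 1) = mat 1"
  by (simp add: vec_eq_iff mat_def)

lemma cadjoint_cadjoint [simp]: "cadjoint (cadjoint A) = A"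
  by (simp add: vec_eq_iff)

lemma matrix_diff_ldistrib: "A ** (B - C) = A ** B - A ** C" for A B C :: "'a::ring_1 ^ 'n::finite ^ 'n"
  by (simp add: vec_eq_iff matrix_matrix_mult_def right_diff_distrib sum_subtractf)

lemma matrix_diff_rdistrib: "(B - C) ** A = B ** A - C ** A" for A B C :: "'a::ring_1 ^ 'n::finite ^ 'n"
  by (simp add: vec_eq_iff matrix_matrix_mult_def left_diff_distrib sum_subtractf)

lemma matrix_add_rdistrib: "(B + C) ** A = B ** A + C ** A" for A B C :: "'a::semiring_1 ^ 'n::finite ^ 'n"
  by (simp add: vec_eq_iff matrix_matrix_mult_def distrib_right sum.distrib)

lemma matrix_inv_unique:
  fixes A B :: "'a::semiring_1 ^ 'n::finite ^ 'n"
  assumes AB: "A ** B = mat 1" and BA: "B ** A = mat 1"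
  shows "matrix_inv A = B"
proof -
  have "A ** matrix_inv A = mat 1 \<and> matrix_inv A ** A = mat 1"
    unfolding matrix_inv_def by (rule someI[of _ B]) (use assms in simp)
  then have "B ** (A ** matrix_inv A) = B" by simp
  then show ?thesis using BA by (simp add: matrix_mul_assoc)
qed

lemma matrix_inv_invertible:
  fixes A :: "'a::semiring_1 ^ 'n::finite ^ 'n"
  assumes "invertible A"
  shows "A ** matrix_inv A = mat 1" "matrix_inv A ** A = mat 1"
  using assms matrix_inv_unique unfolding invertible_def by metis+

text \<open>Put X = \<open>b ** cadjoint \<alpha>\<close>, D = I - X and let R be the inverse of D.
  Since \<alpha> - b = D \<alpha>, the product becomes R^* (D^* + D - D^* D) R = R + R^* - I. On the
  other side, R (I + X) = R (2I - D) = 2R - I, whose real part is the same matrix.\<close>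

lemma Re_mat_cayley_transform:
  fixes b \<alpha> :: "complex ^ 'n::finite ^ 'n"
  assumes \<alpha>: "unitary_mat \<alpha>" and inv: "invertible (mat 1 - b ** cadjoint \<alpha>)"
  shows "matrix_inv (cadjoint \<alpha> - cadjoint b) ** (mat 1 - cadjoint b ** b) ** matrix_inv (\<alpha> - b)
    = Re_mat (matrix_inv (mat 1 - b ** cadjoint \<alpha>) ** (mat 1 + b ** cadjoint \<alpha>))"
proof -
  define X where "X = b ** cadjoint \<alpha>"
  define D where "D = mat 1 - X"
  define R where "R = matrix_inv D"
  have DR: "D ** R = mat 1" and RD: "R ** D = mat 1"
    using matrix_inv_invertible[OF inv] by (auto simp: R_def D_def X_def)
  have a1: "cadjoint \<alpha> ** \<alpha> = mat 1" and a2: "\<alpha> ** cadjoint \<alpha> = mat 1"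
    using \<alpha> by (auto simp: unitary_mat_def)
  have Da: "\<alpha> - b = D ** \<alpha>"
    by (simp add: D_def X_def matrix_diff_rdistrib a1 flip: matrix_mul_assoc)
  have inv1: "matrix_inv (\<alpha> - b) = cadjoint \<alpha> ** R"
  proof (rule matrix_inv_unique)
    have "(\<alpha> - b) ** (cadjoint \<alpha> ** R) = D ** (\<alpha> ** cadjoint \<alpha>) ** R"
      unfolding Da by (simp only: matrix_mul_assoc)
    then show "(\<alpha> - b) ** (cadjoint \<alpha> ** R) = mat 1" by (simp add: a2 DR)
    have "(cadjoint \<alpha> ** R) ** (\<alpha> - b) = cadjoint \<alpha> ** (R ** D) ** \<alpha>"
      unfolding Da by (simp only: matrix_mul_assoc)
    then show "(cadjoint \<alpha> ** R) ** (\<alpha> - b) = mat 1" by (simp add: a1 RD)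
  qed
  have RDs: "cadjoint R ** cadjoint D = mat 1" "cadjoint D ** cadjoint R = mat 1"
    using DR RD by (metis cadjoint_mult cadjoint_mat_1)+
  have inv2: "matrix_inv (cadjoint \<alpha> - cadjoint b) = cadjoint R ** \<alpha>"
  proof (rule matrix_inv_unique)
    have *: "cadjoint \<alpha> - cadjoint b = cadjoint \<alpha> ** cadjoint D"
      using Da by (metis cadjoint_diff cadjoint_mult)
    have "(cadjoint \<alpha> - cadjoint b) ** (cadjoint R ** \<alpha>) = cadjoint \<alpha> ** (cadjoint D ** cadjoint R) ** \<alpha>"
      unfolding * by (simp only: matrix_mul_assoc)
    then show "(cadjoint \<alpha> - cadjoint b) ** (cadjoint R ** \<alpha>) = mat 1" by (simp add: a1 RDs)
    have "(cadjoint R ** \<alpha>) ** (cadjoint \<alpha> - cadjoint b) = cadjoint R ** (\<alpha> ** cadjoint \<alpha>) ** cadjoint D"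
      unfolding * by (simp only: matrix_mul_assoc)
    then show "(cadjoint R ** \<alpha>) ** (cadjoint \<alpha> - cadjoint b) = mat 1" by (simp add: a2 RDs)
  qed
  \<comment> \<open>The left side is I - X^* X, which is expanded in terms of D = I - X.\<close>
  have mid: "\<alpha> ** (mat 1 - cadjoint b ** b) ** cadjoint \<alpha> = cadjoint D + D - cadjoint D ** D"
  proof -
    have "\<alpha> ** (mat 1 - cadjoint b ** b) ** cadjoint \<alpha> = mat 1 - (\<alpha> ** cadjoint b) ** X"
      by (simp add: matrix_diff_ldistrib matrix_diff_rdistrib a2 X_def matrix_mul_assoc)
    also have "\<alpha> ** cadjoint b = cadjoint X" by (simp add: X_def cadjoint_mult)
    finally show ?thesis
      by (simp add: D_def cadjoint_diff matrix_diff_ldistrib matrix_diff_rdistrib)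
  qed
  have "matrix_inv (cadjoint \<alpha> - cadjoint b) ** (mat 1 - cadjoint b ** b) ** matrix_inv (\<alpha> - b)
      = cadjoint R ** (\<alpha> ** (mat 1 - cadjoint b ** b) ** cadjoint \<alpha>) ** R"
    unfolding inv1 inv2 by (simp only: matrix_mul_assoc)
  also have "\<dots> = (cadjoint R ** cadjoint D) ** R + cadjoint R ** (D ** R) - (cadjoint R ** cadjoint D) ** (D ** R)"
    unfolding mid by (simp only: matrix_diff_ldistrib matrix_diff_rdistrib matrix_add_ldistrib matrix_add_rdistrib matrix_mul_assoc)
  also have "\<dots> = R + cadjoint R - mat 1" by (simp add: DR RDs)
  also have "\<dots> = Re_mat (R ** (mat 1 + X))"
  proof -
    have X: "mat 1 + X = mat 1 + mat 1 - D" by (simp add: D_def)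
    have RX: "R ** (mat 1 + X) = R + R - mat 1"
      unfolding X matrix_diff_ldistrib matrix_add_ldistrib RD matrix_mul_rid ..
    show ?thesis
      unfolding Re_mat_def RX by (simp add: vec_eq_iff complex_eq_iff mat_def)
  qed
  finally show ?thesis by (simp add: R_def D_def X_def)
qed

section \<open>Hermitian forms and polarization\<close>

lemma hform_sum: "hform A v = (\<Sum>i\<in>UNIV. \<Sum>j\<in>UNIV. cnj (v $ i) * (A $ i $ j * v $ j))"
  by (simp add: hform_def matrix_vector_mult_def sum_distrib_left)

lemma linear_hform: "linear (\<lambda>A. hform A v)"
  by (intro linearI; simp add: hform_sum sum.distrib algebra_simps scaleR_sum_right)

lemma bounded_linear_hform: "bounded_linear (\<lambda>A. hform A v)"
  by (rule linear_conv_bounded_linear[THEN iffD1, OF linear_hform])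

text \<open>The test vectors of polarization; k matters only modulo 4. As the family is countable,
  almost-everywhere statements hold for all its members at once.\<close>

definition polar_vector :: "'n \<Rightarrow> 'n \<Rightarrow> nat \<Rightarrow> complex ^ 'n::finite" where
  "polar_vector i j k = axis i 1 + axis j (\<i> ^ k)"

lemma sum_mult_axis: "(\<Sum>q\<in>UNIV. f q * axis m c $ q) = f m * c" for f :: "'n::finite \<Rightarrow> complex"
  using sum.delta[of UNIV m "\<lambda>q. f q * c"]
  by (simp add: axis_def if_distrib[of "\<lambda>x. _ * x"] cong: if_cong)

lemma sum_cnj_axis_mult: "(\<Sum>q\<in>UNIV. cnj (axis m c $ q) * f q) = cnj c * f m" for f :: "'n::finite \<Rightarrow> complex"
  using sum.delta[of UNIV m "\<lambda>q. cnj c * f q"]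
  by (simp add: axis_def if_distrib[of cnj] if_distrib[of "\<lambda>x. x * _"] cong: if_cong)

lemma hform_polar_vector:
  "hform A (polar_vector i j k) = A $ i $ i + \<i> ^ k * A $ i $ j + cnj (\<i> ^ k) * A $ j $ i + A $ j $ j"
proof -
  have "hform A (polar_vector i j k) = (\<Sum>p\<in>UNIV. cnj (polar_vector i j k $ p) * (A $ p $ i + A $ p $ j * \<i> ^ k))"
    unfolding hform_sum by (simp add: polar_vector_def distrib_left sum.distrib sum_mult_axis flip: sum_distrib_left)
  also have "\<dots> = (A $ i $ i + A $ i $ j * \<i> ^ k) + cnj (\<i> ^ k) * (A $ j $ i + A $ j $ j * \<i> ^ k)"
    by (simp only: polar_vector_def vector_add_component complex_cnj_add distrib_right sum.distrib sum_cnj_axis_mult) simp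
  also have "cnj (\<i> ^ k) * \<i> ^ k = 1"
    by (simp flip: power_mult_distrib)
  then have "cnj (\<i> ^ k) * (A $ j $ i + A $ j $ j * \<i> ^ k) = cnj (\<i> ^ k) * A $ j $ i + A $ j $ j"
    by (simp add: distrib_left mult.left_commute)
  finally show ?thesis by (simp add: mult.commute)
qed

text \<open>Over the four values of k, the factors cnj (\<i>^k) of the two diagonal entries and
  their squares at the transposed entry sum to 0, while the wanted entry is counted four
  times.\<close>

lemma polarization: "A $ i $ j = (1 / 4) * (\<Sum>k<4. cnj (\<i> ^ k) * hform A (polar_vector i j k))"
  by (simp add: hform_polar_vector eval_nat_numeral algebra_simps)

lemma hform_eqI:
  assumes "\<And>v. hform A v = hform B v"
  shows "A = B"
  by (simp add: vec_eq_iff polarization[of A] polarization[of B] assms)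

lemma nonneg_mat_hform: "nonneg_mat A \<Longrightarrow> hform A v = of_real (Re (hform A v))" "nonneg_mat A \<Longrightarrow> 0 \<le> Re (hform A v)"
  by (auto simp: nonneg_mat_def complex_nonneg_Reals_iff complex_eq_iff)

section \<open>Scalar measures induced by a matrix measure\<close>

lemma space_form_measure [simp]: "space (form_measure M \<mu> v) = space M"
  by (simp add: form_measure_def space_measure_of_conv)

lemma sets_form_measure [simp, measurable_cong]: "sets (form_measure M \<mu> v) = sets M"
  by (simp add: form_measure_def sets.sigma_sets_eq sets_measure_of sets.space_closed)

text \<open>\<open>measure_of\<close> falls back to the zero measure unless its set function is
  positive and countably additive; this check gives \<open>form_measure\<close> its meaning.\<close>

lemma
  assumes \<mu>: "nonneg_matrix_measure M \<mu>"
  shows nonneg_matrix_measure_empty: "\<mu> {} = 0"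
    and emeasure_form_measure: "\<Omega> \<in> sets M \<Longrightarrow> emeasure (form_measure M \<mu> v) \<Omega> = ennreal (Re (hform (\<mu> \<Omega>) v))"
proof -
  have sums: "(\<lambda>k::nat. \<mu> (A k)) sums \<mu> (\<Union>k. A k)" if "range A \<subseteq> sets M" "disjoint_family A" for A
    using \<mu> that by (auto simp: nonneg_matrix_measure_def)
  \<comment> \<open>Apply additivity to the sequence of empty sets: the terms of the convergent
    series are constant and tend to 0.\<close>
  have "(\<lambda>k::nat. \<mu> {}) sums \<mu> {}"
    using sums[of "\<lambda>_. {}"] by (simp add: disjoint_family_on_def)
  then have "(\<lambda>k::nat. \<mu> {}) \<longlonglongrightarrow> 0"
    using sums_summable summable_LIMSEQ_zero by blast
  then show empty: "\<mu> {} = 0" by (simp add: LIMSEQ_const_iff)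
  assume \<Omega>: "\<Omega> \<in> sets M"
  show "emeasure (form_measure M \<mu> v) \<Omega> = ennreal (Re (hform (\<mu> \<Omega>) v))"
    unfolding form_measure_def
  proof (rule emeasure_measure_of_sigma[OF _ _ _ \<Omega>])
    show "sigma_algebra (space M) (sets M)" by (rule sets.sigma_algebra_axioms)
    show "positive (sets M) (\<lambda>\<Omega>. ennreal (Re (hform (\<mu> \<Omega>) v)))"
      using linear_0[OF linear_hform, of v] by (simp add: positive_def empty)
    show "countably_additive (sets M) (\<lambda>\<Omega>. ennreal (Re (hform (\<mu> \<Omega>) v)))"
    proof (rule countably_additiveI)
      fix A :: "nat \<Rightarrow> _" assume A: "range A \<subseteq> sets M" "disjoint_family A"
      have "(\<lambda>k. Re (hform (\<mu> (A k)) v)) sums Re (hform (\<mu> (\<Union>k. A k)) v)"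
        by (intro sums_Re bounded_linear.sums[OF bounded_linear_hform] sums A)
      moreover have "0 \<le> Re (hform (\<mu> (A k)) v)" for k
        using \<mu> A by (intro nonneg_mat_hform) (auto simp: nonneg_matrix_measure_def)
      ultimately show "(\<Sum>k. ennreal (Re (hform (\<mu> (A k)) v))) = ennreal (Re (hform (\<mu> (\<Union>k. A k)) v))"
        by (metis suminf_ennreal_eq)
    qed
  qed
qed

lemma finite_measure_form_measure:
  "nonneg_matrix_measure M \<mu> \<Longrightarrow> finite_measure (form_measure M \<mu> v)"
  by (intro finite_measureI) (simp add: emeasure_form_measure)

lemma measure_form_measure:
  assumes "nonneg_matrix_measure M \<mu>" "\<Omega> \<in> sets M"
  shows "measure (form_measure M \<mu> v) \<Omega> = Re (hform (\<mu> \<Omega>) v)"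
  using assms by (simp add: measure_def emeasure_form_measure nonneg_matrix_measure_def nonneg_mat_hform(2))

lemma hform_eq_measure_form_measure:
  assumes "nonneg_matrix_measure M \<mu>" "\<Omega> \<in> sets M"
  shows "hform (\<mu> \<Omega>) v = of_real (measure (form_measure M \<mu> v) \<Omega>)"
  unfolding measure_form_measure[OF assms]
  using assms by (intro nonneg_mat_hform) (auto simp: nonneg_matrix_measure_def)

section \<open>Transport to the line and Lebesgue decomposition\<close>

text \<open>On the circle this equals \<i> (1 + l) / (1 - l), which is real there. The formula in
  real coordinates is visibly Borel; at l = 1 division by zero gives 0.\<close>

definition cayley_inv :: "complex \<Rightarrow> real" where
  "cayley_inv l = Im l / (Re l - 1)"

lemma cayley_of_real: "cayley (of_real s) = Complex ((s\<^sup>2 - 1) / (s\<^sup>2 + 1)) (- 2 * s / (s\<^sup>2 + 1))"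
proof -
  have nz: "s\<^sup>2 + 1 \<noteq> 0" by (metis add_pos_nonneg add.commute less_numeral_extra(1) less_numeral_extra(3) zero_le_power2)
  have nz': "of_real s + \<i> \<noteq> 0" by (simp add: complex_eq_iff)
  have "(of_real s - \<i>) = Complex ((s\<^sup>2 - 1) / (s\<^sup>2 + 1)) (- 2 * s / (s\<^sup>2 + 1)) * (of_real s + \<i>)"
    using nz by (simp add: complex_eq_iff divide_simps) (simp add: algebra_simps power2_eq_square)
  then show ?thesis unfolding cayley_def using nz' by simp
qed

lemma cayley_of_real_sphere: "cayley (of_real s) \<in> sphere 0 1" and cayley_of_real_neq_1: "cayley (of_real s) \<noteq> 1"
  and cayley_inv_cayley [simp]: "cayley_inv (cayley (of_real s)) = s"
proof -
  have nz: "s\<^sup>2 + 1 \<noteq> 0" by (metis add_pos_nonneg add.commute less_numeral_extra(1) less_numeral_extra(3) zero_le_power2)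
  have "cmod (of_real s - \<i>) = cmod (of_real s + \<i>)" "of_real s + \<i> \<noteq> 0"
    by (simp_all add: cmod_def complex_eq_iff)
  then show "cayley (of_real s) \<in> sphere 0 1" by (simp add: cayley_def norm_divide)
  show "cayley (of_real s) \<noteq> 1"
  proof
    assume "cayley (of_real s) = 1"
    then have "of_real s - \<i> = of_real s + \<i>" by (simp add: cayley_def split: if_splits)
    then show False by (simp add: complex_eq_iff)
  qed
  have "(s\<^sup>2 - 1) / (s\<^sup>2 + 1) - 1 = - 2 / (s\<^sup>2 + 1)" using nz by (simp add: field_simps)
  then show "cayley_inv (cayley (of_real s)) = s"
    unfolding cayley_inv_def cayley_of_real using nz by simp
qed

lemma cayley_cayley_inv:
  assumes "l \<in> sphere 0 1" "l \<noteq> 1"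
  shows "cayley (of_real (cayley_inv l)) = l"
proof -
  obtain x y where l: "l = Complex x y" by (cases l)
  have xy: "x\<^sup>2 + y\<^sup>2 = 1" using assms(1) by (simp add: l cmod_def)
  have "x \<noteq> 1" using assms(2) xy by (auto simp: l complex_eq_iff)
  then have "of_real (cayley_inv l) + \<i> \<noteq> 0" "x - 1 \<noteq> 0" by (auto simp: complex_eq_iff)
  moreover have "of_real (cayley_inv l) - \<i> = l * (of_real (cayley_inv l) + \<i>)"
    using xy \<open>x - 1 \<noteq> 0\<close> by (simp add: l cayley_inv_def complex_eq_iff divide_simps) (simp add: algebra_simps power2_eq_square)
  ultimately show ?thesis by (simp add: cayley_def)
qed

text \<open>Images become preimages, which settles measurability and disjointness. The condition
  \<open>l \<noteq> 1\<close> excludes the default value \<open>cayley_inv 1 = 0\<close>.\<close>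

lemma cayley_image: "(\<lambda>s. cayley (of_real s)) ` \<Omega> = {l \<in> sphere 0 1. l \<noteq> 1 \<and> cayley_inv l \<in> \<Omega>}"
proof (intro set_eqI iffI)
  fix l assume "l \<in> {l \<in> sphere 0 1. l \<noteq> 1 \<and> cayley_inv l \<in> \<Omega>}"
  then show "l \<in> (\<lambda>s. cayley (of_real s)) ` \<Omega>"
    by (intro image_eqI[of _ _ "cayley_inv l"]) (auto simp: cayley_cayley_inv)
qed (auto simp: cayley_of_real_neq_1 cayley_of_real_sphere[simplified])

lemma sets_cayley_image:
  assumes [measurable]: "\<Omega> \<in> sets borel"
  shows "(\<lambda>s. cayley (of_real s)) ` \<Omega> \<in> sets circle_borel"
proof -
  have [measurable]: "cayley_inv \<in> borel_measurable borel"
    unfolding cayley_inv_def[abs_def] by measurable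
  have "{l \<in> space borel. l \<noteq> 1 \<and> cayley_inv l \<in> \<Omega>} \<in> sets borel" by measurable
  then show ?thesis
    unfolding cayley_image by (auto simp: sets_restrict_space intro!: image_eqI[of _ _ "{l \<in> space borel. l \<noteq> 1 \<and> cayley_inv l \<in> \<Omega>}"])
qed

lemma measurable_cayley: "(\<lambda>s. cayley (of_real s)) \<in> borel \<rightarrow>\<^sub>M circle_borel"
proof (rule measurable_restrict_space2)
  show "(\<lambda>s. cayley (of_real s)) \<in> borel_measurable borel"
    unfolding cayley_def by measurable
qed (use cayley_of_real_sphere in auto)

lemma nonneg_matrix_measure_line_measure:
  assumes \<mu>: "nonneg_matrix_measure circle_borel \<mu>"
  shows "nonneg_matrix_measure borel (line_measure \<mu>)"
  unfolding nonneg_matrix_measure_def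
proof safe
  show "nonneg_mat (line_measure \<mu> \<Omega>)" if "\<Omega> \<in> sets borel" for \<Omega>
    using \<mu> sets_cayley_image[OF that] by (simp add: nonneg_matrix_measure_def line_measure_def)
  fix A :: "nat \<Rightarrow> real set" assume A: "range A \<subseteq> sets borel" "disjoint_family A"
  let ?A = "\<lambda>k. (\<lambda>s. cayley (of_real s)) ` A k"
  have "range ?A \<subseteq> sets circle_borel" using A(1) sets_cayley_image by auto
  moreover have "disjoint_family ?A"
    using A(2) unfolding disjoint_family_on_def cayley_image by blast
  ultimately have "(\<lambda>k. \<mu> (?A k)) sums \<mu> (\<Union>k. ?A k)"
    using \<mu> unfolding nonneg_matrix_measure_def by blast
  then show "(\<lambda>k. line_measure \<mu> (A k)) sums line_measure \<mu> (\<Union>k. A k)"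
    by (simp add: line_measure_def image_UN)
qed

lemma cayley_upper_half_plane:
  assumes "w \<in> upper_half_plane"
  shows "1 - (cmod (cayley w))\<^sup>2 = 4 * Im w / (cmod (w + \<i>))\<^sup>2" "cayley w \<in> ball 0 1"
proof -
  have w: "Im w > 0" using assms by (simp add: upper_half_plane_def)
  then have nz: "w + \<i> \<noteq> 0" by (auto simp: complex_eq_iff)
  have "cmod (cayley w) = cmod (w - \<i>) / cmod (w + \<i>)" by (simp add: cayley_def norm_divide)
  then have "1 - (cmod (cayley w))\<^sup>2 = ((cmod (w + \<i>))\<^sup>2 - (cmod (w - \<i>))\<^sup>2) / (cmod (w + \<i>))\<^sup>2"
    using nz by (simp add: power_divide diff_divide_distrib)
  also have "(cmod (w + \<i>))\<^sup>2 - (cmod (w - \<i>))\<^sup>2 = 4 * Im w"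
    by (simp add: cmod_power2) (simp add: power2_eq_square algebra_simps)
  finally show eq: "1 - (cmod (cayley w))\<^sup>2 = 4 * Im w / (cmod (w + \<i>))\<^sup>2" .
  have "0 < 4 * Im w / (cmod (w + \<i>))\<^sup>2" using w nz by simp
  then have "(cmod (cayley w))\<^sup>2 < 1\<^sup>2" using eq by simp
  then show "cayley w \<in> ball 0 1" using power_less_imp_less_base by fastforce
qed

text \<open>The first identity rests on cayley s - cayley w = 2 \<i> (s - w) / ((s + \<i>) (w +
  \<i>)). The second is its limiting case as s tends to infinity, where the circle has its point
  1.\<close>

lemma poisson_kernel_cayley:
  assumes w: "w \<in> upper_half_plane"
  shows "(1 - (cmod (cayley w))\<^sup>2) / (cmod (cayley (of_real s) - cayley w))\<^sup>2 = poisson_line w s"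
    and "(1 - (cmod (cayley w))\<^sup>2) / (cmod (1 - cayley w))\<^sup>2 = Im w"
proof -
  have nz: "w + \<i> \<noteq> 0" "of_real s + \<i> \<noteq> 0" "of_real s \<noteq> w"
    using w by (auto simp: complex_eq_iff upper_half_plane_def)
  have "cayley (of_real s) - cayley w = 2 * \<i> * (of_real s - w) / ((of_real s + \<i>) * (w + \<i>))"
    using nz by (simp add: cayley_def divide_simps) (simp add: algebra_simps)
  then have "(cmod (cayley (of_real s) - cayley w))\<^sup>2
      = 4 * (cmod (of_real s - w))\<^sup>2 / ((cmod (of_real s + \<i>))\<^sup>2 * (cmod (w + \<i>))\<^sup>2)"
    by (simp add: norm_mult norm_divide power_mult_distrib power_divide)
  moreover have "(cmod (of_real s + \<i>))\<^sup>2 = 1 + s\<^sup>2" by (simp add: cmod_power2)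
  ultimately show "(1 - (cmod (cayley w))\<^sup>2) / (cmod (cayley (of_real s) - cayley w))\<^sup>2 = poisson_line w s"
    unfolding cayley_upper_half_plane(1)[OF w] poisson_line_def using nz by (simp add: field_simps)
  have "1 - cayley w = 2 * \<i> / (w + \<i>)" using nz by (simp add: cayley_def divide_simps)
  then have "(cmod (1 - cayley w))\<^sup>2 = 4 / (cmod (w + \<i>))\<^sup>2"
    by (simp add: norm_mult norm_divide power_divide)
  then show "(1 - (cmod (cayley w))\<^sup>2) / (cmod (1 - cayley w))\<^sup>2 = Im w"
    unfolding cayley_upper_half_plane(1)[OF w] using nz by simp
qed

text \<open>The image of the line misses exactly the point 1, so the circle measure is an atom at 1
  plus the push-forward of the line measure.\<close>

lemma integral_circle_eq_line:
  fixes h :: "complex \<Rightarrow> real"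
  assumes \<mu>: "nonneg_matrix_measure circle_borel \<mu>"
    and h: "integrable (form_measure circle_borel \<mu> v) h"
  shows "(\<integral>l. h l \<partial>form_measure circle_borel \<mu> v) = h 1 * measure (form_measure circle_borel \<mu> v) {1}
    + (\<integral>s. h (cayley (of_real s)) \<partial>form_measure borel (line_measure \<mu>) v)"
proof -
  let ?F = "form_measure circle_borel \<mu> v" and ?N = "form_measure borel (line_measure \<mu>) v"
  note \<nu> = nonneg_matrix_measure_line_measure[OF \<mu>]
  have [measurable_cong]: "sets ?F = sets circle_borel" "sets ?N = sets borel" by simp_all
  have [measurable]: "h \<in> borel_measurable circle_borel"
    using borel_measurable_integrable[OF h] by (simp cong: measurable_cong_sets)
  have one: "{1} \<in> sets circle_borel" by (auto simp: sets_restrict_space intro!: image_eqI[of _ _ "{1}"])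
  have sp: "space circle_borel = sphere 0 1" by (simp add: space_restrict_space)
  let ?C = "sphere 0 1 - {1::complex}"
  have C: "?C \<in> sets circle_borel" using sets.Diff[OF sets.top one] by (simp add: sp)
  have distr: "distr ?N circle_borel (\<lambda>s. cayley (of_real s)) = density ?F (indicator ?C)"
  proof (rule measure_eqI)
    fix A assume "A \<in> sets (distr ?N circle_borel (\<lambda>s. cayley (of_real s)))"
    then have A: "A \<in> sets circle_borel" by simp
    have A': "(\<lambda>s. cayley (of_real s)) -` A \<in> sets borel"
      using measurable_sets[OF measurable_cayley A] by simp
    have "A \<subseteq> sphere 0 1" using sets.sets_into_space[OF A] by (simp add: sp)
    then have im: "(\<lambda>s. cayley (of_real s)) ` ((\<lambda>s. cayley (of_real s)) -` A) = ?C \<inter> A"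
      unfolding cayley_image by (auto simp: cayley_cayley_inv)
    have "emeasure (distr ?N circle_borel (\<lambda>s. cayley (of_real s))) A
        = emeasure ?N ((\<lambda>s. cayley (of_real s)) -` A)"
      by (subst emeasure_distr) (use A measurable_cayley in \<open>auto cong: measurable_cong_sets\<close>)
    also have "\<dots> = emeasure ?F (?C \<inter> A)"
      using A A' C by (simp add: emeasure_form_measure[OF \<nu>] emeasure_form_measure[OF \<mu>] line_measure_def im del: image_vimage_eq)
    also have "\<dots> = emeasure (density ?F (indicator ?C)) A"
      using A C by (subst emeasure_density)
        (auto simp: indicator_inter_arith[symmetric] simp flip: nn_integral_indicator)
    finally show "emeasure (distr ?N circle_borel (\<lambda>s. cayley (of_real s))) A = emeasure (density ?F (indicator ?C)) A" .
  qed simp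
  have int: "integrable ?F (\<lambda>l. indicator A l * h l)" if "A \<in> sets circle_borel" for A
    using integrable_mult_indicator[of A ?F h] that h by simp
  have "(\<integral>l. h l \<partial>?F) = (\<integral>l. indicator {1} l * h l + indicator ?C l * h l \<partial>?F)"
    by (rule Bochner_Integration.integral_cong) (auto simp: sp split: split_indicator)
  also have "\<dots> = (\<integral>l. indicator {1} l * h l \<partial>?F) + (\<integral>l. indicator ?C l * h l \<partial>?F)"
    by (intro Bochner_Integration.integral_add int one C)
  also have "(\<integral>l. indicator {1} l * h l \<partial>?F) = (\<integral>l. h 1 * indicator {1} l \<partial>?F)"
    by (rule Bochner_Integration.integral_cong) (auto split: split_indicator)
  also have "\<dots> = h 1 * measure ?F {1}" by (simp add: sp)
  also have "(\<integral>l. indicator ?C l * h l \<partial>?F) = (\<integral>l. h l \<partial>density ?F (indicator ?C))"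
    using integral_density[of h ?F "indicator ?C"] C by (simp add: ennreal_indicator)
  also have "\<dots> = (\<integral>s. h (cayley (of_real s)) \<partial>?N)"
    unfolding distr[symmetric]
    by (rule integral_distr) (use measurable_cayley in \<open>auto cong: measurable_cong_sets\<close>)
  finally show ?thesis .
qed

section \<open>Lebesgue decomposition of a matrix measure\<close>

lemma nonneg_matrix_measure_Int:
  assumes \<mu>: "nonneg_matrix_measure M \<mu>" and Z: "Z \<in> sets M"
  shows "nonneg_matrix_measure M (\<lambda>\<Omega>. \<mu> (\<Omega> \<inter> Z))"
  unfolding nonneg_matrix_measure_def
proof safe
  show "nonneg_mat (\<mu> (\<Omega> \<inter> Z))" if "\<Omega> \<in> sets M" for \<Omega>
    using \<mu> Z that by (simp add: nonneg_matrix_measure_def)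
  fix A :: "nat \<Rightarrow> _" assume A: "range A \<subseteq> sets M" "disjoint_family A"
  have "range (\<lambda>k. A k \<inter> Z) \<subseteq> sets M" "disjoint_family (\<lambda>k. A k \<inter> Z)"
    using A Z by (auto simp: disjoint_family_on_def)
  then have "(\<lambda>k. \<mu> (A k \<inter> Z)) sums \<mu> (\<Union>k. A k \<inter> Z)"
    using \<mu> unfolding nonneg_matrix_measure_def by blast
  then show "(\<lambda>k. \<mu> (A k \<inter> Z)) sums \<mu> ((\<Union>k. A k) \<inter> Z)" by simp
qed

text \<open>\<open>Z\<close> is a null set of the largest possible \<open>T\<close>-measure.\<close>

lemma exhausting_null_set:
  assumes fin: "finite_measure T" and sets: "sets T = sets M"
  obtains Z where "Z \<in> null_sets M" "\<And>\<Omega>. \<Omega> \<in> null_sets M \<Longrightarrow> measure T (\<Omega> - Z) = 0"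
proof -
  interpret finite_measure T by fact
  let ?S = "measure T ` null_sets M"
  have bdd: "bdd_above ?S" by (intro bdd_aboveI[of _ "measure T (space T)"]) (auto intro: bounded_measure)
  \<comment> \<open>Null sets whose masses approach the supremum; their countable union is null and
    attains it.\<close>
  have "\<exists>Z\<in>null_sets M. Sup ?S - 1 / real (Suc n) < measure T Z" for n
    using less_cSup_iff[of ?S "Sup ?S - 1 / real (Suc n)"] bdd by (auto simp: ex_in_conv[symmetric])
  then obtain Zn where Zn: "\<And>n. Zn n \<in> null_sets M" "\<And>n. Sup ?S - 1 / real (Suc n) < measure T (Zn n)"
    by metis
  define Z where "Z = (\<Union>n. Zn n)"
  have Z: "Z \<in> null_sets M" unfolding Z_def using Zn(1) by (intro null_sets_UN) auto
  have Zs: "Z \<in> sets T" using Z sets by auto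
  have le: "Sup ?S \<le> measure T Z"
  proof (rule field_le_epsilon)
    fix e :: real assume "e > 0"
    then obtain n where "1 / real (Suc n) < e" using nat_approx_posE by metis
    moreover have "measure T (Zn n) \<le> measure T Z"
      by (intro finite_measure_mono Zs) (auto simp: Z_def)
    ultimately show "Sup ?S \<le> measure T Z + e" using Zn(2)[of n] by linarith
  qed
  have "measure T (\<Omega> - Z) = 0" if \<Omega>: "\<Omega> \<in> null_sets M" for \<Omega>
  proof -
    \<comment> \<open>Enlarging \<open>Z\<close> by another null set cannot exceed the supremum that
      \<open>Z\<close> attains, so the added part has mass 0.\<close>
    have "Z \<union> (\<Omega> - Z) \<in> null_sets M" using Z \<Omega> by auto
    then have "measure T (Z \<union> (\<Omega> - Z)) \<le> Sup ?S" by (intro cSup_upper bdd imageI)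
    moreover have "measure T (Z \<union> (\<Omega> - Z)) = measure T Z + measure T (\<Omega> - Z)"
      using \<Omega> sets Zs by (intro finite_measure_Union) auto
    ultimately show ?thesis using le measure_nonneg[of T "\<Omega> - Z"] by linarith
  qed
  with Z show thesis by (rule that)
qed

lemma (in sigma_finite_measure) absolutely_continuous_real_density:
  assumes N: "finite_measure N" and ac: "absolutely_continuous M N" and sets: "sets N = sets M"
  shows "\<exists>D. integrable M D \<and> (\<forall>\<Omega>\<in>sets M. measure N \<Omega> = (LINT x:\<Omega>|M. D x :: real))"
proof -
  interpret N: finite_measure N by fact
  obtain D where D: "D \<in> borel_measurable M" "AE x in M. RN_deriv M N x = ennreal (D x)" "\<And>x. 0 \<le> D x"
    using real_RN_deriv[OF N ac sets] by metis
  have em: "emeasure N \<Omega> = (\<integral>\<^sup>+x. ennreal (indicator \<Omega> x * D x) \<partial>M)" if "\<Omega> \<in> sets M" for \<Omega>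
  proof -
    have "emeasure N \<Omega> = (\<integral>\<^sup>+x. RN_deriv M N x * indicator \<Omega> x \<partial>M)"
      using density_RN_deriv[OF ac sets] that by (metis emeasure_density borel_measurable_RN_deriv)
    also have "\<dots> = (\<integral>\<^sup>+x. ennreal (indicator \<Omega> x * D x) \<partial>M)"
      by (rule nn_integral_cong_AE) (use D(2) in \<open>auto elim!: eventually_mono split: split_indicator\<close>)
    finally show ?thesis .
  qed
  have int: "integrable M D"
  proof (rule integrableI_nonneg)
    have "(\<integral>\<^sup>+x. ennreal (D x) \<partial>M) = emeasure N (space M)"
      unfolding em[OF sets.top] by (rule nn_integral_cong) simp
    also have "\<dots> < \<infinity>" by (simp add: N.emeasure_eq_measure)
    finally show "(\<integral>\<^sup>+x. ennreal (D x) \<partial>M) < \<infinity>" .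
  qed (use D in auto)
  moreover have "measure N \<Omega> = (LINT x:\<Omega>|M. D x)" if "\<Omega> \<in> sets M" for \<Omega>
  proof -
    have "emeasure N \<Omega> = ennreal (\<integral>x. indicator \<Omega> x * D x \<partial>M)"
      unfolding em[OF that] using integrable_mult_indicator[OF that int] D(3)
      by (intro nn_integral_eq_integral) auto
    then show ?thesis
      using D(3) by (simp add: measure_def set_lebesgue_integral_def integral_nonneg_AE)
  qed
  ultimately show ?thesis by blast
qed

text \<open>Expand W in matrix units, each a bounded linear image of one entry.\<close>

lemma integrable_cmat:
  fixes W :: "'a \<Rightarrow> complex ^ 'n::finite ^ 'm::finite"
  assumes "\<And>i j. integrable M (\<lambda>s. W s $ i $ j)"
  shows "integrable M W"
proof -
  have bl: "bounded_linear (\<lambda>z. axis i (axis j z) :: complex ^ 'n ^ 'm)" for i j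
    by (rule linear_conv_bounded_linear[THEN iffD1]) (auto intro!: linearI simp: vec_eq_iff axis_def)
  have "(\<Sum>b\<in>UNIV. if c then f b else 0) = (if c then sum f UNIV else 0)" for c and f :: "'n \<Rightarrow> complex"
    by simp
  then have "W = (\<lambda>s. \<Sum>i\<in>UNIV. \<Sum>j\<in>UNIV. axis i (axis j (W s $ i $ j)))"
    by (simp add: fun_eq_iff vec_eq_iff axis_def if_distrib[of "\<lambda>x. x $ _"] cong: if_cong)
  moreover have "integrable M (\<lambda>s. \<Sum>i\<in>UNIV. \<Sum>j\<in>UNIV. axis i (axis j (W s $ i $ j)) :: complex ^ 'n ^ 'm)"
    by (intro Bochner_Integration.integrable_sum integrable_bounded_linear[OF bl] assms)
  ultimately show ?thesis by metis
qed

lemma set_integral_bounded_linear: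
  fixes T :: "'b::{banach, second_countable_topology} \<Rightarrow> 'c::{banach, second_countable_topology}"
  assumes T: "bounded_linear T" and f: "integrable M f" and \<Omega>: "\<Omega> \<in> sets M"
  shows "T (LINT s:\<Omega>|M. f s) = (LINT s:\<Omega>|M. T (f s))"
proof -
  have "(LINT s:\<Omega>|M. T (f s)) = (\<integral>s. T (indicator \<Omega> s *\<^sub>R f s) \<partial>M)"
    unfolding set_lebesgue_integral_def by (simp add: linear_cmul[OF bounded_linear.linear[OF T]])
  also have "\<dots> = T (LINT s:\<Omega>|M. f s)"
    unfolding set_lebesgue_integral_def
    by (rule integral_bounded_linear[OF T integrable_mult_indicator[OF \<Omega> f]])
  finally show ?thesis ..
qed

text \<open>Restricting \<nu> to one common null set and to its complement keeps both parts
  nonnegative. Scalar Radon-Nikodym densities are taken for the polar vectors only and reassembled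
  by polarization.\<close>

lemma lebesgue_decomposition_exists:
  fixes \<nu> :: "real set \<Rightarrow> complex ^ 'n::finite ^ 'n"
  assumes \<nu>: "nonneg_matrix_measure borel \<nu>"
  shows "\<exists>W \<nu>a \<nu>s. lebesgue_decomposition \<nu> \<nu>a \<nu>s \<and> has_lebesgue_density \<nu>a W"
proof -
  let ?N = "form_measure borel \<nu>"
  have fin: "finite_measure (?N v)" for v by (rule finite_measure_form_measure[OF \<nu>])
  have "\<exists>Z\<in>null_sets lborel. \<forall>\<Omega>\<in>null_sets lborel. measure (?N v) (\<Omega> - Z) = 0" for v
  proof -
    obtain Z where "Z \<in> null_sets lborel" "\<And>\<Omega>. \<Omega> \<in> null_sets lborel \<Longrightarrow> measure (?N v) (\<Omega> - Z) = 0"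
      by (rule exhausting_null_set[OF fin, of v lborel]) auto
    then show ?thesis by blast
  qed
  then obtain Zv where Zv: "\<And>v. Zv v \<in> null_sets lborel"
    "\<And>v \<Omega>. \<Omega> \<in> null_sets lborel \<Longrightarrow> measure (?N v) (\<Omega> - Zv v) = 0"
    by metis
  \<comment> \<open>A countable union of the exhausting null sets, hence null and large enough for
    every polar vector.\<close>
  define Z where "Z = (\<Union>(i, j, k)\<in>UNIV \<times> UNIV \<times> (UNIV :: nat set). Zv (polar_vector i j k))"
  have Z: "Z \<in> null_sets lborel"
    unfolding Z_def by (rule null_sets_UN') (auto simp: Zv)
  have Zb: "Z \<in> sets borel" using Z by auto
  define \<nu>a where "\<nu>a = (\<lambda>\<Omega>. \<nu> (\<Omega> \<inter> - Z))"
  define \<nu>s where "\<nu>s = (\<lambda>\<Omega>. \<nu> (\<Omega> \<inter> Z))"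
  have \<nu>a: "nonneg_matrix_measure borel \<nu>a" and \<nu>s: "nonneg_matrix_measure borel \<nu>s"
    unfolding \<nu>a_def \<nu>s_def using Zb by (auto intro!: nonneg_matrix_measure_Int[OF \<nu>])
  have add: "\<nu> \<Omega> = \<nu>a \<Omega> + \<nu>s \<Omega>" if \<Omega>: "\<Omega> \<in> sets borel" for \<Omega>
  proof (rule hform_eqI)
    fix v
    interpret N: finite_measure "?N v" by (rule fin)
    have "measure (?N v) ((\<Omega> \<inter> - Z) \<union> (\<Omega> \<inter> Z)) = measure (?N v) (\<Omega> \<inter> - Z) + measure (?N v) (\<Omega> \<inter> Z)"
      using \<Omega> Zb by (intro N.finite_measure_Union) auto
    moreover have "(\<Omega> \<inter> - Z) \<union> (\<Omega> \<inter> Z) = \<Omega>" by auto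
    ultimately have "measure (?N v) \<Omega> = measure (?N v) (\<Omega> \<inter> - Z) + measure (?N v) (\<Omega> \<inter> Z)" by simp
    then show "hform (\<nu> \<Omega>) v = hform (\<nu>a \<Omega> + \<nu>s \<Omega>) v"
      using \<Omega> Zb by (simp add: linear_add[OF linear_hform] \<nu>a_def \<nu>s_def hform_eq_measure_form_measure[OF \<nu>])
  qed
  have null_v: "hform (\<nu>a \<Omega>) (polar_vector i j k) = 0" if \<Omega>: "\<Omega> \<in> null_sets lborel" for \<Omega> i j k
  proof -
    let ?v = "polar_vector i j k"
    interpret N: finite_measure "?N ?v" by (rule fin)
    have \<Omega>b: "\<Omega> \<in> sets borel" "Zv ?v \<in> sets borel" using \<Omega> Zv(1)[of ?v] by auto
    then have "measure (?N ?v) (\<Omega> \<inter> - Z) \<le> measure (?N ?v) (\<Omega> - Zv ?v)"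
      by (intro N.finite_measure_mono) (auto simp: Z_def)
    also have "\<dots> = 0" by (rule Zv(2)[OF \<Omega>])
    finally have "measure (?N ?v) (\<Omega> \<inter> - Z) = 0" using measure_nonneg[of "?N ?v"] by (simp add: order_antisym)
    then show ?thesis
      using Zb \<Omega>b by (simp add: \<nu>a_def hform_eq_measure_form_measure[OF \<nu>])
  qed
  have null: "\<nu>a \<Omega> = 0" if "\<Omega> \<in> null_sets lborel" for \<Omega>
    by (simp add: vec_eq_iff polarization[of "\<nu>a \<Omega>"] null_v[OF that])
  have "lebesgue_decomposition \<nu> \<nu>a \<nu>s"
    unfolding lebesgue_decomposition_def
  proof (intro conjI bexI[of _ Z] ballI impI)
    show "\<nu>s \<Omega> = 0" if "\<Omega> \<inter> Z = {}" for \<Omega>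
      using nonneg_matrix_measure_empty[OF \<nu>] that by (simp add: \<nu>s_def)
  qed (use \<nu>a \<nu>s add null Z in auto)
  moreover
  have "\<exists>D. integrable lborel D \<and> (\<forall>\<Omega>\<in>sets borel. hform (\<nu>a \<Omega>) (polar_vector i j k) = of_real (LBINT x:\<Omega>. D x))" for i j k
  proof -
    let ?N = "form_measure borel \<nu>a (polar_vector i j k)"
    have "absolutely_continuous lborel ?N"
      unfolding absolutely_continuous_def
      by (auto simp: null_sets_def emeasure_form_measure[OF \<nu>a] null_v[unfolded null_sets_def])
    then have "\<exists>D. integrable lborel D \<and> (\<forall>\<Omega>\<in>sets lborel. measure ?N \<Omega> = (LBINT x:\<Omega>. D x))"
      by (intro lborel.absolutely_continuous_real_density finite_measure_form_measure \<nu>a) auto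
    then show ?thesis by (auto simp: hform_eq_measure_form_measure[OF \<nu>a])
  qed
  then obtain D where D: "\<And>i j k. integrable lborel (D i j k)"
    "\<And>i j k \<Omega>. \<Omega> \<in> sets borel \<Longrightarrow> hform (\<nu>a \<Omega>) (polar_vector i j k) = of_real (LBINT x:\<Omega>. D i j k x)"
    by metis
  \<comment> \<open>The polarization formula with the scalar densities in place of the forms, so
    that integrating W entrywise reproduces the entries of \<open>\<nu>a\<close>.\<close>
  define W where "W = (\<lambda>s. \<chi> i j. (1 / 4) * (\<Sum>k<4. cnj (\<i> ^ k) * of_real (D i j k s)))"
  have W: "integrable lborel W"
    by (rule integrable_cmat) (simp add: W_def D(1))
  have "\<nu>a \<Omega> = (LBINT s:\<Omega>. W s)" if \<Omega>: "\<Omega> \<in> sets borel" for \<Omega>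
  proof -
    have "(LBINT s:\<Omega>. W s) $ i $ j = \<nu>a \<Omega> $ i $ j" for i j
    proof -
      have bl: "bounded_linear (\<lambda>A :: complex ^ 'n ^ 'n. A $ i $ j)"
        by (intro bounded_linear_compose[OF bounded_linear_vec_nth bounded_linear_vec_nth])
      have "(LBINT s:\<Omega>. W s) $ i $ j = (LBINT s:\<Omega>. W s $ i $ j)"
        using set_integral_bounded_linear[OF bl W, of \<Omega>] \<Omega> by simp
      also have "\<dots> = (\<integral>s. (1 / 4) * (\<Sum>k<4. cnj (\<i> ^ k) * of_real (indicator \<Omega> s * D i j k s)) \<partial>lborel)"
        unfolding set_lebesgue_integral_def W_def
        by (rule Bochner_Integration.integral_cong) (auto split: split_indicator)
      also have "\<dots> = (1 / 4) * (\<Sum>k<4. cnj (\<i> ^ k) * of_real (LBINT s:\<Omega>. D i j k s))"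
      proof -
        have [simp]: "integrable lborel (\<lambda>s. indicator \<Omega> s * D i j k s)" for k
          using integrable_mult_indicator[OF _ D(1), of \<Omega> i j k] \<Omega> by simp
        show ?thesis
          by (simp add: set_lebesgue_integral_def integral_sum del: of_real_mult)
      qed
      also have "\<dots> = \<nu>a \<Omega> $ i $ j"
        unfolding polarization[of "\<nu>a \<Omega>"] D(2)[OF \<Omega>] ..
      finally show ?thesis .
    qed
    then show ?thesis by (simp add: vec_eq_iff)
  qed
  then have "has_lebesgue_density \<nu>a W" using W by (simp add: has_lebesgue_density_def)
  ultimately show ?thesis by blast
qed

section \<open>Boundary values of the Clark measure\<close>

text \<open>Unpacks the choice behind \<open>ac_weight\<close> into the hypotheses of
  \<open>fatou_line\<close>: off the null set that carries the singular part, \<nu> is its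
  absolutely continuous part.\<close>

lemma ac_weight_properties:
  fixes \<nu> :: "real set \<Rightarrow> complex ^ 'n::finite ^ 'n"
  assumes \<nu>: "nonneg_matrix_measure borel \<nu>"
  shows "integrable lborel (\<lambda>s. Re (hform (ac_weight \<nu> s) v))"
    and "AE s in lborel. hform (ac_weight \<nu> s) v = of_real (Re (hform (ac_weight \<nu> s) v))"
    and "\<exists>Z\<in>null_sets lborel. \<forall>\<Omega>\<in>sets borel. \<Omega> \<inter> Z = {} \<longrightarrow>
      measure (form_measure borel \<nu> v) \<Omega> = (LBINT s:\<Omega>. Re (hform (ac_weight \<nu> s) v))"
proof -
  let ?W = "ac_weight \<nu>"
  obtain \<nu>a \<nu>s where dec: "lebesgue_decomposition \<nu> \<nu>a \<nu>s" and den: "has_lebesgue_density \<nu>a ?W"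
    using someI_ex[OF lebesgue_decomposition_exists[OF \<nu>]] unfolding ac_weight_def by blast
  have W: "integrable lborel ?W" using den by (simp add: has_lebesgue_density_def)
  have blRe: "bounded_linear (\<lambda>A :: complex ^ 'n ^ 'n. Re (hform A v))"
    by (intro bounded_linear_compose[OF bounded_linear_Re bounded_linear_hform])
  have blIm: "bounded_linear (\<lambda>A :: complex ^ 'n ^ 'n. Im (hform A v))"
    by (intro bounded_linear_compose[OF bounded_linear_Im bounded_linear_hform])
  show "integrable lborel (\<lambda>s. Re (hform (?W s) v))"
    by (rule integrable_bounded_linear[OF blRe W])
  have intIm: "integrable lborel (\<lambda>s. Im (hform (?W s) v))"
    by (rule integrable_bounded_linear[OF blIm W])
  have Im0: "(LBINT s:\<Omega>. Im (hform (?W s) v)) = 0" if \<Omega>: "\<Omega> \<in> sets borel" for \<Omega>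
  proof -
    have "(LBINT s:\<Omega>. Im (hform (?W s) v)) = Im (hform (\<nu>a \<Omega>) v)"
      using set_integral_bounded_linear[OF blIm W, of \<Omega>] den \<Omega> by (simp add: has_lebesgue_density_def)
    also have "\<dots> = 0"
      using dec \<Omega> nonneg_mat_hform(1)[of "\<nu>a \<Omega>" v]
      by (auto simp: lebesgue_decomposition_def nonneg_matrix_measure_def complex_eq_iff)
    finally show ?thesis .
  qed
  \<comment> \<open>The imaginary part integrates to 0 over every Borel set, so both it and its
    negative are nonnegative almost everywhere.\<close>
  have "AE s in lborel. 0 \<le> Im (hform (?W s) v)"
    by (rule AE_nonneg_of_set_integral_nonneg[OF intIm]) (simp add: Im0)
  moreover have "AE s in lborel. 0 \<le> - Im (hform (?W s) v)"
    using intIm by (intro AE_nonneg_of_set_integral_nonneg) (use Im0 in \<open>auto simp: set_lebesgue_integral_def\<close>)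
  ultimately show "AE s in lborel. hform (?W s) v = of_real (Re (hform (?W s) v))"
    by eventually_elim (simp add: complex_eq_iff)
  obtain Z where Z: "Z \<in> null_sets lborel" "\<And>\<Omega>. \<Omega> \<in> sets borel \<Longrightarrow> \<Omega> \<inter> Z = {} \<Longrightarrow> \<nu>s \<Omega> = 0"
    using dec unfolding lebesgue_decomposition_def by blast
  have "measure (form_measure borel \<nu> v) \<Omega> = (LBINT s:\<Omega>. Re (hform (?W s) v))"
    if \<Omega>: "\<Omega> \<in> sets borel" "\<Omega> \<inter> Z = {}" for \<Omega>
  proof -
    have "\<nu> \<Omega> = (LBINT s:\<Omega>. ?W s)"
      using dec den Z(2)[OF \<Omega>] \<Omega>(1) by (simp add: lebesgue_decomposition_def has_lebesgue_density_def)
    then show ?thesis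
      using set_integral_bounded_linear[OF blRe W, of \<Omega>] \<Omega>(1) by (simp add: measure_form_measure[OF \<nu>])
  qed
  with Z(1) show "\<exists>Z\<in>null_sets lborel. \<forall>\<Omega>\<in>sets borel. \<Omega> \<inter> Z = {} \<longrightarrow>
      measure (form_measure borel \<nu> v) \<Omega> = (LBINT s:\<Omega>. Re (hform (?W s) v))" by blast
qed

text \<open>For fixed v the form of the chosen density is real almost everywhere, so the real limit
  can be stated for the complex form itself, to which polarization applies.\<close>

lemma fatou_form_measure:
  fixes \<nu> :: "real set \<Rightarrow> complex ^ 'n::finite ^ 'n"
  assumes \<nu>: "nonneg_matrix_measure borel \<nu>"
  shows "AE s in lborel. \<forall>c. ((\<lambda>w. complex_of_real (\<integral>t. poisson_line w t \<partial>form_measure borel \<nu> v)) \<longlongrightarrow>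
    of_real (pi * (1 + s\<^sup>2)) * hform (ac_weight \<nu> s) v) (at (of_real s) within stolz_cone s c)"
proof -
  obtain Z where Z: "Z \<in> null_sets lborel" "\<forall>\<Omega>\<in>sets borel. \<Omega> \<inter> Z = {} \<longrightarrow>
      measure (form_measure borel \<nu> v) \<Omega> = (LBINT s:\<Omega>. Re (hform (ac_weight \<nu> s) v))"
    by (rule bexE[OF ac_weight_properties(3)[OF \<nu>, of v]])
  have "AE s in lborel. \<forall>c. ((\<lambda>w. \<integral>t. poisson_line w t \<partial>form_measure borel \<nu> v) \<longlongrightarrow>
    pi * (1 + s\<^sup>2) * Re (hform (ac_weight \<nu> s) v)) (at (of_real s) within stolz_cone s c)"
    using Z(2) by (intro fatou_line[OF finite_measure_form_measure[OF \<nu>] _ Z(1) ac_weight_properties(1)[OF \<nu>]]) simp_all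
  then show ?thesis
    using ac_weight_properties(2)[OF \<nu>, of v]
  proof eventually_elim
    case (elim s)
    have eq: "complex_of_real (pi * (1 + s\<^sup>2) * Re (hform (ac_weight \<nu> s) v)) = of_real (pi * (1 + s\<^sup>2)) * hform (ac_weight \<nu> s) v"
      by (subst (2) elim(2)) (rule of_real_mult)
    show ?case
      unfolding eq[symmetric] using elim(1) by (intro allI tendsto_of_real) (erule spec)
  qed
qed

lemma hform_Re_mat_clark:
  assumes clark: "is_clark_measure b \<alpha> \<mu>" and w: "w \<in> upper_half_plane"
  shows "hform (Re_mat (matrix_inv (mat 1 - b (cayley w) ** cadjoint \<alpha>) ** (mat 1 + b (cayley w) ** cadjoint \<alpha>))) v
    = of_real (Im w * measure (form_measure circle_borel \<mu> v) {1}
        + (\<integral>t. poisson_line w t \<partial>form_measure borel (line_measure \<mu>) v))"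
proof -
  let ?h = "\<lambda>l. (1 - (cmod (cayley w))\<^sup>2) / (cmod (l - cayley w))\<^sup>2"
  have \<mu>: "nonneg_matrix_measure circle_borel \<mu>" using clark by (simp add: is_clark_measure_def)
  have h: "integrable (form_measure circle_borel \<mu> v) ?h"
    and eq: "hform (Re_mat (matrix_inv (mat 1 - b (cayley w) ** cadjoint \<alpha>) ** (mat 1 + b (cayley w) ** cadjoint \<alpha>))) v
      = of_real (\<integral>l. ?h l \<partial>form_measure circle_borel \<mu> v)"
    using clark cayley_upper_half_plane(2)[OF w] by (auto simp: is_clark_measure_def has_matrix_integral_def)
  show ?thesis
    unfolding eq integral_circle_eq_line[OF \<mu> h] poisson_kernel_cayley[OF w] ..
qed

theorem theorem4:
  fixes B b :: "complex \<Rightarrow> complex ^ 'n::finite ^ 'n"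
    and \<alpha> :: "complex ^ 'n ^ 'n"
    and \<mu> :: "complex set \<Rightarrow> complex ^ 'n ^ 'n"
  assumes "B \<in> schur_class upper_half_plane"
    and "unitary_mat \<alpha>"
    and "\<And>w. w \<in> upper_half_plane \<Longrightarrow> B w = b (cayley w)"
    and "\<And>\<zeta>. \<zeta> \<in> ball 0 1 \<Longrightarrow> invertible (mat 1 - b \<zeta> ** cadjoint \<alpha>)"
    and "is_clark_measure b \<alpha> \<mu>"
  shows "AE s in lborel. \<exists>L.
      has_nontangential_limit
        (\<lambda>w. matrix_inv (cadjoint \<alpha> - cadjoint (B w)) **
              (mat 1 - cadjoint (B w) ** B w) ** matrix_inv (\<alpha> - B w)) s L \<and>
      ac_weight (line_measure \<mu>) s = (1 / (pi * (1 + s\<^sup>2))) *\<^sub>R L"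
proof -
  let ?\<nu> = "line_measure \<mu>"
  let ?F = "\<lambda>w. matrix_inv (cadjoint \<alpha> - cadjoint (B w)) **
              (mat 1 - cadjoint (B w) ** B w) ** matrix_inv (\<alpha> - B w)"
  let ?m = "\<lambda>v. measure (form_measure circle_borel \<mu> v) {1}"
  let ?P = "\<lambda>v w. \<integral>t. poisson_line w t \<partial>form_measure borel ?\<nu> v"
  have \<nu>: "nonneg_matrix_measure borel ?\<nu>"
    using assms(5) by (intro nonneg_matrix_measure_line_measure) (simp add: is_clark_measure_def)
  have F: "hform (?F w) v = of_real (Im w) * of_real (?m v) + of_real (?P v w)" if w: "w \<in> upper_half_plane" for w v
    unfolding assms(3)[OF w]
      Re_mat_cayley_transform[OF assms(2) assms(4)[OF cayley_upper_half_plane(2)[OF w]]]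
      hform_Re_mat_clark[OF assms(5) w] by simp
  \<comment> \<open>The countable family of polar vectors gives a single exceptional null set for
    all of them.\<close>
  have "AE s in lborel. \<forall>i j k. \<forall>c. ((\<lambda>w. complex_of_real (?P (polar_vector i j k) w)) \<longlongrightarrow>
      of_real (pi * (1 + s\<^sup>2)) * hform (ac_weight ?\<nu> s) (polar_vector i j k)) (at (of_real s) within stolz_cone s c)"
    unfolding AE_all_countable by (intro allI fatou_form_measure \<nu>)
  then show ?thesis
  proof eventually_elim
    case (elim s)
    let ?L = "(pi * (1 + s\<^sup>2)) *\<^sub>R ac_weight ?\<nu> s"
    have "1 + s\<^sup>2 \<noteq> 0" by (metis add_pos_nonneg less_numeral_extra(1) less_numeral_extra(3) zero_le_power2)
    then have "ac_weight ?\<nu> s = (1 / (pi * (1 + s\<^sup>2))) *\<^sub>R ?L" by simp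
    moreover have "has_nontangential_limit ?F s ?L"
      unfolding has_nontangential_limit_def
    proof (intro allI impI vec_tendstoI)
      fix c :: real and i j
      let ?A = "at (of_real s) within stolz_cone s c"
      have "((\<lambda>w. hform (?F w) (polar_vector i j k)) \<longlongrightarrow> hform ?L (polar_vector i j k)) ?A" for k
      proof (rule Lim_transform_eventually)
        let ?v = "polar_vector i j k"
        \<comment> \<open>The atom at the circle point 1 enters only through \<open>Im w\<close>,
          whose limit at the real point s is 0.\<close>
        have "((\<lambda>w. of_real (Im w) * of_real (?m ?v) + of_real (?P ?v w)) \<longlongrightarrow>
            of_real (Im (of_real s)) * of_real (?m ?v) + of_real (pi * (1 + s\<^sup>2)) * hform (ac_weight ?\<nu> s) ?v) ?A"
          using elim by (intro tendsto_intros) blast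
        moreover have "hform ?L ?v = of_real (pi * (1 + s\<^sup>2)) * hform (ac_weight ?\<nu> s) ?v"
          unfolding linear_cmul[OF linear_hform] by (simp only: scaleR_conv_of_real)
        ultimately show "((\<lambda>w. of_real (Im w) * of_real (?m ?v) + of_real (?P ?v w)) \<longlongrightarrow> hform ?L ?v) ?A"
          by simp
        show "\<forall>\<^sub>F w in ?A. of_real (Im w) * of_real (?m ?v) + of_real (?P ?v w) = hform (?F w) ?v"
          unfolding eventually_at_filter by (rule always_eventually) (use F in auto)
      qed
      \<comment> \<open>Each entry is a finite linear combination of the four forms whose limits are
        known.\<close>
      then show "((\<lambda>w. ?F w $ i $ j) \<longlongrightarrow> ?L $ i $ j) ?A"
        by (subst (1 2) polarization) (intro tendsto_intros)
    qed
    ultimately show ?case by blast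
  qed
qed

end
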